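(* Let $(A,L,[\cdot,\cdot],\rho)$ be a Lie-Rinehart superalgebra over a field $\mathbb{K}$ of characteristic zero, and let $m\in\mathrm{Der}^1(L,L)$ be the bracket $m=[\cdot,\cdot]$, with symbol map $\sigma_m=\rho$. Set $C^n_{def}(L,L)=\mathrm{Der}^{n-1}(L,L)$ for $n\ge 0$. Then the operator \[\delta:C^n_{def}(L,L)\to C^{n+1}_{def}(L,L),\qquad \delta D=[m,D],\] is a differential, i.e. $\delta^2=0$.
   Context: $|x|\in\mathbb{Z}_2$ denotes the degree of a homogeneous element; identities are for homogeneous elements. A superderivation of $A$ of degree $|D|$ is a homogeneous linear map with $D(ab)=D(a)b+(-1)^{|a||D|}aD(b)$; $\mathrm{Der}(A)$ is the Lie superalgebra of superderivations with the supercommutator. A Lie-Rinehart superalgebra $(A,L,[\cdot,\cdot],\rho)$ over $\mathbb{K}$ consists of an associative supercommutative $\mathbb{K}$-superalgebra $A$, a Lie superalgebra $L$ over $\mathbb{K}$ (even bracket, $[x,y]=-(-1)^{|x||y|}[y,x]$, $[x,[y,z]]=[[x,y],z]+(-1)^{|x||y|}[y,[x,z]]$), an $A$-module structure on $L$ with $|ax|=|a|+|x|$, and an even Lie superalgebra morphism $\rho:L\to\mathrm{Der}(A)$ with $[x,ay]=\rho(x)(a)y+(-1)^{|a||x|}a[x,y]$ and $\rho(ax)(b)=a\rho(x)(b)$. For $n\ge 0$, $\mathrm{Der}^n(L,L)$ is the space of $\mathbb{K}$-multilinear maps $f:L^{\times(n+1)}\to L$ for which there exists a map $\sigma_f:L^{\otimes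 n}\to\mathrm{Der}(A)$ (symbol map) such that: (1) $f(x_1,\dots,x_i,x_{i+1},\dots,x_{n+1})=-(-1)^{|x_i||x_{i+1}|}f(x_1,\dots,x_{i+1},x_i,\dots,x_{n+1})$ for $1\le i\le n$; (2) $f(x_1,\dots,x_n,ax_{n+1})=(-1)^{|a|(|f|+|x_1|+\cdots+|x_n|)}af(x_1,\dots,x_{n+1})+\sigma_f(x_1,\dots,x_n)(a)x_{n+1}$ for all $a\in A$. Here $|f|=j$ means $|f(x_1,\dots,x_{n+1})|-\sum_i|x_i|=j$ mod 2, and $\mathrm{Der}^n=\mathrm{Der}^n_0\oplus\mathrm{Der}^n_1$. Set $\mathrm{Der}^{-1}(L,L)=L$. For $f\in\mathrm{Der}^p(L,L)$, $g\in\mathrm{Der}^q(L,L)$, set \[(f\circ g)(x_1,\dots,x_{p+q+1})=\sum_{\tau}\varepsilon(\tau,x_1,\dots,x_{p+q+1})\,f\big(g(x_{\tau(1)},\dots,x_{\tau(q+1)}),x_{\tau(q+2)},\dots,x_{\tau(p+q+1)}\big),\] summing over permutations $\tau$ of $\{1,\dots,p+q+1\}$ with $\tau(1)<\cdots<\tau(q+1)$ and $\tau(q+2)<\cdots<\tau(p+q+1)$, where $\varepsilon(\tau,x_1,\dots)$ is $\mathrm{sgn}(\tau)$ times the Koszul sign of the permutation of the homogeneous $x_i$ (an adjacent transposition of $x_i,x_{i+1}$ contributes $-(-1)^{|x_i||x_{i+1}|}$). If $g\in L$ ($q=-1$), $(f\circ g)(x_1,\dots,x_p)=f(g,x_1,\dots,x_p)$;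 if $f\in L$ ($p=-1$), $f\circ g=0$. The bracket is $[f,g]=f\circ g-(-1)^{pq}g\circ f\in\mathrm{Der}^{p+q}(L,L)$. *)

theory Defs
  imports Complex_Main "HOL-Library.Z2" "HOL-Combinatorics.Permutations"
begin

section \<open>Superspaces\<close>

text \<open>Degrees live in the two-element field \<^typ>\<open>bit\<close>.  A grading is a function
  \<open>G\<close> assigning to each degree its homogeneous subspace; \<open>x \<in> G d\<close> reads
  ``\<open>x\<close> is homogeneous and \<open>|x| = d\<close>'' (zero has both degrees).\<close>

locale superspace = vector_space scale
  for scale :: "'k::field \<Rightarrow> 'v::ab_group_add \<Rightarrow> 'v" +
  fixes G :: "bit \<Rightarrow> 'v set"
  assumes subspace_G: "subspace (G d)"
    and G_direct: "G 0 \<inter> G 1 = {0}"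
    and G_sum: "\<exists>y\<in>G 0. \<exists>z\<in>G 1. x = y + z"

definition psign :: "bit \<Rightarrow> 'k::field" where
  "psign d = (if d = 0 then 1 else - 1)"

definition component :: "(bit \<Rightarrow> 'v::ab_group_add set) \<Rightarrow> bit \<Rightarrow> 'v \<Rightarrow> 'v" where
  "component G d x = (THE y. y \<in> G d \<and> x - y \<in> G (d + 1))"

definition homogeneous :: "(bit \<Rightarrow> 'v set) \<Rightarrow> bit list \<Rightarrow> 'v list \<Rightarrow> bool" where
  "homogeneous G ds xs \<longleftrightarrow> list_all2 (\<lambda>d x. x \<in> G d) ds xs"

section \<open>Superderivations and Lie-Rinehart superalgebras\<close>

locale supercommutative_superalgebra = superspace sA GA
  for sA :: "'k::field \<Rightarrow> 'a::ring \<Rightarrow> 'a" and GA :: "bit \<Rightarrow> 'a set" +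
  assumes scale_mult_left: "sA c (a * b) = sA c a * b"
    and scale_mult_right: "sA c (a * b) = a * sA c b"
    and mult_degree: "a \<in> GA i \<Longrightarrow> b \<in> GA j \<Longrightarrow> a * b \<in> GA (i + j)"
    and supercommute: "a \<in> GA i \<Longrightarrow> b \<in> GA j \<Longrightarrow> a * b = sA (psign (i * j)) (b * a)"

definition superderivation ::
  "('k::field \<Rightarrow> 'a::ring \<Rightarrow> 'a) \<Rightarrow> (bit \<Rightarrow> 'a set) \<Rightarrow> bit \<Rightarrow> ('a \<Rightarrow> 'a) \<Rightarrow> bool" where
  "superderivation sA GA d D \<longleftrightarrow>
     Vector_Spaces.linear sA sA D \<and>
     (\<forall>i. \<forall>a\<in>GA i. D a \<in> GA (d + i)) \<and>
     (\<forall>i j. \<forall>a\<in>GA i. \<forall>b\<in>GA j. D (a * b) = D a * b + sA (psign (i * d)) (a * D b))"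

definition DerA :: "('k::field \<Rightarrow> 'a::ring \<Rightarrow> 'a) \<Rightarrow> (bit \<Rightarrow> 'a set) \<Rightarrow> ('a \<Rightarrow> 'a) set" where
  "DerA sA GA =
     {\<lambda>a. D0 a + D1 a | D0 D1. superderivation sA GA 0 D0 \<and> superderivation sA GA 1 D1}"

locale lie_superalgebra = superspace sL GL
  for sL :: "'k::field \<Rightarrow> 'l::ab_group_add \<Rightarrow> 'l" and GL :: "bit \<Rightarrow> 'l set" +
  fixes br :: "'l \<Rightarrow> 'l \<Rightarrow> 'l"
  assumes br_linear_left: "Vector_Spaces.linear sL sL (\<lambda>x. br x y)"
    and br_linear_right: "Vector_Spaces.linear sL sL (br x)"
    and br_even: "x \<in> GL i \<Longrightarrow> y \<in> GL j \<Longrightarrow> br x y \<in> GL (i + j)"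
    and br_skew: "x \<in> GL i \<Longrightarrow> y \<in> GL j \<Longrightarrow> br x y = - sL (psign (i * j)) (br y x)"
    and br_jacobi: "x \<in> GL i \<Longrightarrow> y \<in> GL j \<Longrightarrow> z \<in> GL k \<Longrightarrow>
          br x (br y z) = br (br x y) z + sL (psign (i * j)) (br y (br x z))"

locale lie_rinehart_superalgebra =
  A: supercommutative_superalgebra sA GA + L: lie_superalgebra sL GL br
  for sA :: "'k::field \<Rightarrow> 'a::ring \<Rightarrow> 'a" and GA :: "bit \<Rightarrow> 'a set"
    and sL :: "'k \<Rightarrow> 'l::ab_group_add \<Rightarrow> 'l" and GL :: "bit \<Rightarrow> 'l set"
    and br :: "'l \<Rightarrow> 'l \<Rightarrow> 'l" +
  fixes act :: "'a \<Rightarrow> 'l \<Rightarrow> 'l" and \<rho> :: "'l \<Rightarrow> 'a \<Rightarrow> 'a"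
  assumes act_linear_left: "Vector_Spaces.linear sA sL (\<lambda>a. act a x)"
    and act_linear_right: "Vector_Spaces.linear sL sL (act a)"
    and act_assoc: "act (a * b) x = act a (act b x)"
    and act_degree: "a \<in> GA i \<Longrightarrow> x \<in> GL j \<Longrightarrow> act a x \<in> GL (i + j)"
    and rho_linear: "Vector_Spaces.linear sL sA (\<lambda>x. \<rho> x a)"
    and rho_even: "x \<in> GL i \<Longrightarrow> superderivation sA GA i (\<rho> x)"
    and rho_br: "x \<in> GL i \<Longrightarrow> y \<in> GL j \<Longrightarrow>
          \<rho> (br x y) a = \<rho> x (\<rho> y a) - sA (psign (i * j)) (\<rho> y (\<rho> x a))"
    and br_act: "x \<in> GL i \<Longrightarrow> a \<in> GA j \<Longrightarrow>
          br x (act a y) = act (\<rho> x a) y + sL (psign (j * i)) (act a (br x y))"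
    and rho_act: "\<rho> (act a x) b = a * \<rho> x b"

section \<open>Multiderivations\<close>

text \<open>A map of \<open>k\<close> arguments is a function on lists which is zero on every list whose length
  is not \<open>k\<close>, so that equality of such maps is equality of functions.\<close>

definition multilinear ::
  "('k::field \<Rightarrow> 'l::ab_group_add \<Rightarrow> 'l) \<Rightarrow> ('k \<Rightarrow> 'v::ab_group_add \<Rightarrow> 'v) \<Rightarrow> nat
     \<Rightarrow> ('l list \<Rightarrow> 'v) \<Rightarrow> bool" where
  "multilinear s t k f \<longleftrightarrow>
     (\<forall>xs i. length xs = k \<and> i < k \<longrightarrow> Vector_Spaces.linear s t (\<lambda>x. f (xs[i := x])))"

definition is_symbol ::
  "('k::field \<Rightarrow> 'a::ring \<Rightarrow> 'a) \<Rightarrow> (bit \<Rightarrow> 'a set) \<Rightarrow>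
   ('k \<Rightarrow> 'l::ab_group_add \<Rightarrow> 'l) \<Rightarrow> (bit \<Rightarrow> 'l set) \<Rightarrow> ('a \<Rightarrow> 'l \<Rightarrow> 'l) \<Rightarrow>
   nat \<Rightarrow> bit \<Rightarrow> ('l list \<Rightarrow> 'l) \<Rightarrow> ('l list \<Rightarrow> 'a \<Rightarrow> 'a) \<Rightarrow> bool" where
  "is_symbol sA GA sL GL act n j f \<sigma> \<longleftrightarrow>
     (\<forall>xs. length xs = n \<longrightarrow> \<sigma> xs \<in> DerA sA GA) \<and>
     (\<forall>a. multilinear sL sA n (\<lambda>xs. \<sigma> xs a)) \<and>
     (\<forall>ds xs e a y. length xs = n \<and> homogeneous GL ds xs \<and> a \<in> GA e \<longrightarrow>
        f (xs @ [act a y]) =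
          sL (psign (e * (j + sum_list ds))) (act a (f (xs @ [y]))) + act (\<sigma> xs a) y)"

definition Der_homogeneous ::
  "('k::field \<Rightarrow> 'a::ring \<Rightarrow> 'a) \<Rightarrow> (bit \<Rightarrow> 'a set) \<Rightarrow>
   ('k \<Rightarrow> 'l::ab_group_add \<Rightarrow> 'l) \<Rightarrow> (bit \<Rightarrow> 'l set) \<Rightarrow> ('a \<Rightarrow> 'l \<Rightarrow> 'l) \<Rightarrow>
   nat \<Rightarrow> bit \<Rightarrow> ('l list \<Rightarrow> 'l) set" where
  "Der_homogeneous sA GA sL GL act n j = {f.
     (\<forall>xs. length xs \<noteq> n + 1 \<longrightarrow> f xs = 0) \<and>
     multilinear sL sL (n + 1) f \<and>
     (\<forall>ds xs. length xs = n + 1 \<and> homogeneous GL ds xs \<longrightarrow> f xs \<in> GL (j + sum_list ds)) \<and>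
     (\<forall>ds xs i. length xs = n + 1 \<and> homogeneous GL ds xs \<and> i < n \<longrightarrow>
        f xs = - sL (psign (ds ! i * ds ! (i + 1)))
                   (f (xs[i := xs ! (i + 1), i + 1 := xs ! i]))) \<and>
     (\<exists>\<sigma>. is_symbol sA GA sL GL act n j f \<sigma>)}"

definition Der ::
  "('k::field \<Rightarrow> 'a::ring \<Rightarrow> 'a) \<Rightarrow> (bit \<Rightarrow> 'a set) \<Rightarrow>
   ('k \<Rightarrow> 'l::ab_group_add \<Rightarrow> 'l) \<Rightarrow> (bit \<Rightarrow> 'l set) \<Rightarrow> ('a \<Rightarrow> 'l \<Rightarrow> 'l) \<Rightarrow>
   nat \<Rightarrow> ('l list \<Rightarrow> 'l) set" where
  "Der sA GA sL GL act n =
     {\<lambda>xs. f0 xs + f1 xs | f0 f1. f0 \<in> Der_homogeneous sA GA sL GL act n 0 \<and>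
                                  f1 \<in> Der_homogeneous sA GA sL GL act n 1}"

text \<open>The cochain space of degree \<open>n\<close> is \<open>Der\<close> in degree \<open>n - 1\<close>.  For \<open>n = 0\<close> this is
  \<open>L\<close> itself, an element \<open>u\<close> of \<open>L\<close> being the map of no arguments with value \<open>u\<close> at
  the empty list.\<close>

definition Cdef ::
  "('k::field \<Rightarrow> 'a::ring \<Rightarrow> 'a) \<Rightarrow> (bit \<Rightarrow> 'a set) \<Rightarrow>
   ('k \<Rightarrow> 'l::ab_group_add \<Rightarrow> 'l) \<Rightarrow> (bit \<Rightarrow> 'l set) \<Rightarrow> ('a \<Rightarrow> 'l \<Rightarrow> 'l) \<Rightarrow>
   nat \<Rightarrow> ('l list \<Rightarrow> 'l) set" where
  "Cdef sA GA sL GL act n =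
     (case n of 0 \<Rightarrow> {f. \<forall>xs. xs \<noteq> [] \<longrightarrow> f xs = 0}
      | Suc k \<Rightarrow> Der sA GA sL GL act k)"

section \<open>Composition, bracket and the operator\<close>

text \<open>Positions are numbered from \<open>0\<close>, so permutations act on \<open>{..<n}\<close>.\<close>

definition shuffles_of :: "nat \<Rightarrow> nat \<Rightarrow> (nat \<Rightarrow> nat) set" where
  "shuffles_of l n = {\<tau>. \<tau> permutes {..<n} \<and> strict_mono_on {..<l} \<tau> \<and> strict_mono_on {l..<n} \<tau>}"

text \<open>The factor \<open>\<epsilon>(\<tau>, x)\<close> for arguments of degrees \<open>ds\<close>: each inversion of \<open>\<tau>\<close> moves two
  arguments past each other and contributes the Koszul sign of that pair.\<close>

definition eps :: "(nat \<Rightarrow> nat) \<Rightarrow> bit list \<Rightarrow> 'k::field" where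
  "eps \<tau> ds = of_int (sign \<tau>) *
     (\<Prod>(i, j)\<in>{(i, j). i < j \<and> j < length ds \<and> \<tau> j < \<tau> i}. psign (ds ! \<tau> i * ds ! \<tau> j))"

text \<open>\<open>circ sL GL p q f g\<close> is \<open>f \<circ> g\<close> for \<open>f\<close> of degree \<open>p\<close> and \<open>g\<close> of degree \<open>q\<close>,
  where \<open>p, q \<ge> -1\<close>.  The defining formula involves the degrees of the arguments; it is extended
  multilinearly to all arguments by summing over their homogeneous components.  For \<open>q = -1\<close> the
  identity is the only shuffle, and the formula reads \<open>f (g, x\<^sub>1, \<dots>, x\<^sub>p)\<close>.\<close>

definition circ ::
  "('k::field \<Rightarrow> 'l::ab_group_add \<Rightarrow> 'l) \<Rightarrow> (bit \<Rightarrow> 'l set) \<Rightarrow> int \<Rightarrow> int \<Rightarrow>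
   ('l list \<Rightarrow> 'l) \<Rightarrow> ('l list \<Rightarrow> 'l) \<Rightarrow> 'l list \<Rightarrow> 'l" where
  "circ sL GL p q f g xs =
     (let n = nat (p + q + 1); l = nat (q + 1) in
      if p < 0 \<or> length xs \<noteq> n then 0
      else (\<Sum>ds\<in>{ds. length ds = n}. \<Sum>\<tau>\<in>shuffles_of l n.
              let x = (\<lambda>i. component GL (ds ! i) (xs ! i)) in
              sL (eps \<tau> ds)
                (f (g (map (\<lambda>i. x (\<tau> i)) [0..<l]) # map (\<lambda>i. x (\<tau> i)) [l..<n]))))"

definition Der_bracket ::
  "('k::field \<Rightarrow> 'l::ab_group_add \<Rightarrow> 'l) \<Rightarrow> (bit \<Rightarrow> 'l set) \<Rightarrow> int \<Rightarrow> int \<Rightarrow>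
   ('l list \<Rightarrow> 'l) \<Rightarrow> ('l list \<Rightarrow> 'l) \<Rightarrow> 'l list \<Rightarrow> 'l" where
  "Der_bracket sL GL p q f g xs =
     circ sL GL p q f g xs - sL ((- 1) powi (p * q)) (circ sL GL q p g f xs)"

definition bracket_map :: "('l::ab_group_add \<Rightarrow> 'l \<Rightarrow> 'l) \<Rightarrow> 'l list \<Rightarrow> 'l" where
  "bracket_map br xs = (case xs of [x, y] \<Rightarrow> br x y | _ \<Rightarrow> 0)"

definition delta ::
  "('k::field \<Rightarrow> 'l::ab_group_add \<Rightarrow> 'l) \<Rightarrow> (bit \<Rightarrow> 'l set) \<Rightarrow> ('l \<Rightarrow> 'l \<Rightarrow> 'l) \<Rightarrow>
   nat \<Rightarrow> ('l list \<Rightarrow> 'l) \<Rightarrow> 'l list \<Rightarrow> 'l" where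
  "delta sL GL br n D = Der_bracket sL GL 1 (int n - 1) (bracket_map br) D"

end

theory Submission
  imports Defs "Jordan_Normal_Form.Determinant"
begin

text \<open>Write \<open>i\<^sub>u D\<close> for \<open>D\<close> with the homogeneous element \<open>u\<close> put into its first argument.  Splitting the
  unshuffles in \<open>\<delta> D = [m, D]\<close> by the position of the first argument gives Cartan's formula
  \<open>i\<^sub>u \<delta> D = \<delta> (i\<^sub>u D) \<plusminus> R\<^sub>u D\<close>, where \<open>R\<^sub>u\<close> is the Lie derivative along \<open>u\<close>.  The Jacobi identity makes
  \<open>R\<close> a right action, which gives \<open>R\<^sub>u \<delta> = \<delta> R\<^sub>u\<close> and then \<open>\<delta> \<delta> = 0\<close>, each by induction on the number of
  arguments.  Skew-symmetry of \<open>\<delta> D\<close> and the existence of a symbol follow by the same recursion.\<close>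

text \<open>The usual route derives \<open>\<delta> \<delta> = 0\<close> from
  \<open>[m, m] = 0\<close> and the graded Jacobi identity for the bracket of multiderivations,
  hence from an identity between double sums over unshuffles. The recursion in the first argument
  avoids double sums: unshuffles enter only when \<open>delta\<close> is compared with
  \<open>lie_diff\<close>. In that comparison arguments are moved to the head, so the map must be
  skew-symmetric. A second application of \<open>\<delta>\<close> therefore presupposes
  skew-symmetry of \<open>\<delta> D\<close>.

  Signs depend on the degrees of the arguments, and zero has both degrees. Arguments therefore carry
  their degree as a label, and the recursions live on functions of labelled lists. The Lie
  derivative of a map depends on the labels through its signs even if the map itself ignores them,
  so the inductions must run in this larger class. \<open>multi_ext\<close> leads back to plain
  arguments.\<close>

section \<open>Signs and gradings\<close>

text \<open>These simp rules turn ring expressions in degrees into bit operations, to which the ring laws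
  no longer apply.\<close>

declare add_bit_eq_xor [simp del] mult_bit_eq_and [simp del]

lemma bit_add_self [simp]: "(d::bit) + d = 0"
  by (cases d) auto

lemma bit_add_self_left [simp]: "(d::bit) + (d + e) = e"
  by (cases d; cases e) auto

lemma bit_mult_self [simp]: "(d::bit) * d = d"
  by (cases d) auto

text \<open>A sign acts on any abelian group and not through a scalar field, so that the same rules
  serve \<open>A\<close> and \<open>L\<close>; composed signs collapse into a single
  exponent.\<close>

definition signed :: "bit \<Rightarrow> 'v::ab_group_add \<Rightarrow> 'v" where
  "signed d x = (if d = 0 then x else - x)"

lemma signed_0 [simp]: "signed 0 x = x" and signed_1 [simp]: "signed 1 x = - x"
  and signed_zero [simp]: "signed d 0 = 0"
  by (simp_all add: signed_def)

lemma signed_signed [simp]: "signed d (signed e x) = signed (d + e) x"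
  by (cases d; cases e) auto

lemma signed_add: "signed d (x + y) = signed d x + signed d y"
  by (cases d) auto

lemma signed_minus: "signed d (- x) = - signed d x"
  by (cases d) auto

lemma signed_diff: "signed d (x - y) = signed d x - signed d y"
  by (cases d) auto

lemma signed_Suc: "signed (1 + d) x = - signed d x"
  by (cases d) auto

definition total_degree :: "(bit \<times> 'v) list \<Rightarrow> bit" where
  "total_degree zs = sum_list (map fst zs)"

lemma total_degree_simps [simp]: "total_degree [] = 0" "total_degree (z # zs) = fst z + total_degree zs" "total_degree (zs @ zs') = total_degree zs + total_degree zs'"
  by (simp_all add: total_degree_def)

abbreviation parity :: "'z list \<Rightarrow> bit" where
  "parity zs \<equiv> of_nat (length zs)"

context vector_space
begin

lemma scale_psign: "scale (psign d) x = signed d x"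
  by (cases d) (auto simp: psign_def)

lemma scale_signed: "scale c (signed d x) = signed d (scale c x)"
  by (cases d) auto

end

text \<open>No length is fixed here: a map of \<open>n\<close> arguments vanishes on all other lists, so the condition is
  void there.\<close>

definition slot_linear :: "('k::field \<Rightarrow> 'l::ab_group_add \<Rightarrow> 'l) \<Rightarrow> ('k \<Rightarrow> 'v::ab_group_add \<Rightarrow> 'v) \<Rightarrow>
    ((bit \<times> 'l) list \<Rightarrow> 'v) \<Rightarrow> bool" where
  "slot_linear s t D \<longleftrightarrow> (\<forall>zs d c x y zs'.
     D (zs @ (d, s c x + y) # zs') = t c (D (zs @ (d, x) # zs')) + D (zs @ (d, y) # zs'))"

lemma slot_linearD: "slot_linear s t D \<Longrightarrow>
    D (zs @ (d, s c x + y) # zs') = t c (D (zs @ (d, x) # zs')) + D (zs @ (d, y) # zs')"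
  unfolding slot_linear_def by blast

lemma slot_linear_Cons: "slot_linear s t D \<Longrightarrow> slot_linear s t (\<lambda>zs. D (z # zs))"
  unfolding slot_linear_def by (metis append_Cons)

lemma slot_linear_hd: "slot_linear s t D \<Longrightarrow> D ((d, s c x + y) # zs) = t c (D ((d, x) # zs)) + D ((d, y) # zs)"
  using slot_linearD[of s t D "[]"] by simp

definition all_hom :: "(bit \<Rightarrow> 'l set) \<Rightarrow> (bit \<times> 'l) list \<Rightarrow> bool" where
  "all_hom G zs \<longleftrightarrow> (\<forall>(d, x)\<in>set zs. x \<in> G d)"

lemma all_hom_simps [simp]: "all_hom G []" "all_hom G (z # zs) \<longleftrightarrow> snd z \<in> G (fst z) \<and> all_hom G zs"
  "all_hom G (zs @ zs') \<longleftrightarrow> all_hom G zs \<and> all_hom G zs'"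
  by (auto simp: all_hom_def)

section \<open>Homogeneous components\<close>

context superspace
begin

lemma G_add: "x \<in> G d \<Longrightarrow> y \<in> G d \<Longrightarrow> x + y \<in> G d"
  and G_scale: "x \<in> G d \<Longrightarrow> scale c x \<in> G d"
  and G_zero [simp]: "0 \<in> G d"
  and G_minus: "x \<in> G d \<Longrightarrow> - x \<in> G d"
  and G_diff: "x \<in> G d \<Longrightarrow> y \<in> G d \<Longrightarrow> x - y \<in> G d"
  using subspace_G[of d] by (simp_all add: subspace_add subspace_scale subspace_0 subspace_neg subspace_diff)

lemma G_signed: "x \<in> G d \<Longrightarrow> signed e x \<in> G d"
  by (cases e) (auto intro: G_minus)

lemma G_both: "x \<in> G d \<Longrightarrow> x \<in> G e \<Longrightarrow> d \<noteq> e \<Longrightarrow> x = 0"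
  using G_direct by (cases d; cases e) auto

lemma component_unique:
  assumes "y \<in> G d" "x - y \<in> G (d + 1)"
  shows "component G d x = y"
  unfolding component_def
proof (rule the_equality)
  show "y \<in> G d \<and> x - y \<in> G (d + 1)" using assms by blast
next
  fix z assume z: "z \<in> G d \<and> x - z \<in> G (d + 1)"
  have "z - y \<in> G d" using z assms G_diff by blast
  moreover have "z - y = (x - y) - (x - z)" by simp
  then have "z - y \<in> G (d + 1)" using z assms G_diff by metis
  ultimately have "z - y = 0" using G_both[of "z - y" d "d + 1"] by simp
  then show "z = y" by simp
qed

lemma component_spec: "component G d x \<in> G d" "x - component G d x \<in> G (d + 1)"
proof -
  obtain y z where yz: "y \<in> G 0" "z \<in> G 1" "x = y + z" using G_sum by blast
  have "\<exists>u. u \<in> G d \<and> x - u \<in> G (d + 1)"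
  proof (cases d)
    case zero then show ?thesis using yz by (intro exI[of _ y]) auto
  next
    case one then show ?thesis using yz by (intro exI[of _ z]) auto
  qed
  then show "component G d x \<in> G d" "x - component G d x \<in> G (d + 1)"
    using component_unique by auto
qed

lemma component_linear:
  "component G d (scale c x + y) = scale c (component G d x) + component G d y"
proof (rule component_unique)
  show "scale c (component G d x) + component G d y \<in> G d"
    by (intro G_add G_scale component_spec)
  have "scale c x + y - (scale c (component G d x) + component G d y)
      = scale c (x - component G d x) + (y - component G d y)"
    by (simp add: scale_right_diff_distrib)
  then show "scale c x + y - (scale c (component G d x) + component G d y) \<in> G (d + 1)"
    by (metis G_add G_scale component_spec(2))
qed

lemma component_same: "x \<in> G d \<Longrightarrow> component G d x = x"
  by (rule component_unique) auto

lemma component_other: "x \<in> G e \<Longrightarrow> e \<noteq> d \<Longrightarrow> component G d x = 0"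
  by (rule component_unique) (cases d; cases e; auto)+

lemma component_decomp: "component G 0 x + component G 1 x = x"
proof -
  have "component G 1 x = x - component G 0 x"
    using component_spec[where d = 0 and x = x] by (intro component_unique) auto
  then show ?thesis by simp
qed

end

context lie_superalgebra
begin

lemma br_add_left: "br (x + y) z = br x z + br y z"
  and br_scale_left: "br (sL c x) z = sL c (br x z)"
  and br_zero_left [simp]: "br 0 z = 0"
  and br_minus_left: "br (- x) z = - br x z"
proof -
  interpret l: Vector_Spaces.linear sL sL "\<lambda>x. br x z" by (rule br_linear_left)
  show "br (x + y) z = br x z + br y z" "br (sL c x) z = sL c (br x z)" "br 0 z = 0"
    "br (- x) z = - br x z"
    by (simp_all add: l.add l.scale l.zero l.neg)
qed

lemma br_add_right: "br z (x + y) = br z x + br z y"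
  and br_scale_right: "br z (sL c x) = sL c (br z x)"
  and br_zero_right [simp]: "br z 0 = 0"
  and br_minus_right: "br z (- x) = - br z x"
proof -
  interpret l: Vector_Spaces.linear sL sL "br z" by (rule br_linear_right)
  show "br z (x + y) = br z x + br z y" "br z (sL c x) = sL c (br z x)" "br z 0 = 0"
    "br z (- x) = - br z x"
    by (simp_all add: l.add l.scale l.zero l.neg)
qed

lemma br_signed_left: "br (signed d x) z = signed d (br x z)" and br_signed_right: "br z (signed d x) = signed d (br z x)"
  by (cases d; simp add: br_minus_left br_minus_right)+

lemma skew: "x \<in> GL i \<Longrightarrow> y \<in> GL j \<Longrightarrow> br x y = - signed (i * j) (br y x)"
  using br_skew[of x i y j] by (simp add: scale_psign)

lemma jacobi: "x \<in> GL i \<Longrightarrow> y \<in> GL j \<Longrightarrow> z \<in> GL k \<Longrightarrow>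
    br x (br y z) = br (br x y) z + signed (i * j) (br y (br x z))"
  using br_jacobi[of x i y j z k] by (simp add: scale_psign)

lemma jacobi_right_hom:
  assumes "x \<in> GL i" "y \<in> GL j" "z \<in> GL k"
  shows "br (br x y) z = br x (br y z) + signed (j * k) (br (br x z) y)"
proof -
  have "br y (br x z) = - signed (j * (i + k)) (br (br x z) y)"
    by (rule skew) (use assms br_even in auto)
  then have "br x (br y z) = br (br x y) z - signed (i * j + j * (i + k)) (br (br x z) y)"
    unfolding jacobi[OF assms] by (simp add: signed_minus)
  moreover have "i * j + j * (i + k) = j * k"
    by (cases i; cases j) auto
  ultimately show ?thesis by simp
qed

text \<open>The element \<open>x\<close> is going to be a value of \<open>D\<close>, which need not
  be homogeneous. The only sign involves the degrees of \<open>y\<close> and \<open>z\<close>, so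
  the identities for the two components of \<open>x\<close> add up.\<close>

lemma jacobi_right:
  assumes "y \<in> GL j" "z \<in> GL k"
  shows "br (br x y) z = br x (br y z) + signed (j * k) (br (br x z) y)"
proof -
  let ?c = "\<lambda>d. component GL d x"
  have "br (br (?c d) y) z = br (?c d) (br y z) + signed (j * k) (br (br (?c d) z) y)" for d
    using jacobi_right_hom component_spec(1) assms by blast
  from this[of 0] this[of 1] show ?thesis
    by (subst (1 2 3) component_decomp[of x, symmetric])
      (simp add: br_add_left signed_add)
qed

section \<open>Cartan calculus on labelled arguments\<close>

definition pair_bracket :: "bit \<times> 'l \<Rightarrow> bit \<times> 'l \<Rightarrow> bit \<times> 'l" where
  "pair_bracket u v = (fst u + fst v, br (snd u) (snd v))"

lemma pair_bracket_hom: "snd u \<in> GL (fst u) \<Longrightarrow> snd v \<in> GL (fst v) \<Longrightarrow> snd (pair_bracket u v) \<in> GL (fst (pair_bracket u v))"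
  by (auto simp: pair_bracket_def br_even)

lemma fst_pair_bracket [simp]: "fst (pair_bracket u v) = fst u + fst v"
  by (simp add: pair_bracket_def)

text \<open>\<open>u\<close> is moved past the later arguments only, and acts on the value of \<open>D\<close> from the right; thus no
  sign depends on the degree of \<open>D\<close>, which need not be homogeneous.\<close>

primrec lie_deriv :: "((bit \<times> 'l) list \<Rightarrow> 'l) \<Rightarrow> bit \<times> 'l \<Rightarrow> (bit \<times> 'l) list \<Rightarrow> 'l" where
  "lie_deriv D u [] = br (D []) (snd u)"
| "lie_deriv D u (v # zs) = D (pair_bracket u v # zs) + signed (fst u * fst v) (lie_deriv (\<lambda>zs. D (v # zs)) u zs)"

text \<open>Cartan's formula, taken as a definition of \<open>\<delta>\<close> on homogeneous arguments.\<close>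

primrec lie_diff :: "((bit \<times> 'l) list \<Rightarrow> 'l) \<Rightarrow> (bit \<times> 'l) list \<Rightarrow> 'l" where
  "lie_diff D [] = 0"
| "lie_diff D (u # zs) = lie_diff (\<lambda>zs. D (u # zs)) zs + signed (parity zs) (lie_deriv D u zs)"

lemma lie_deriv_linear: "lie_deriv (\<lambda>zs. sL c (D zs) + E zs) u zs = sL c (lie_deriv D u zs) + lie_deriv E u zs"
  by (induction zs arbitrary: D E)
    (simp_all add: br_add_left br_scale_left signed_add scale_right_distrib scale_signed)

lemma lie_deriv_add: "lie_deriv (\<lambda>zs. D zs + E zs) u zs = lie_deriv D u zs + lie_deriv E u zs"
  using lie_deriv_linear[of 1] by simp

lemma lie_deriv_zero [simp]: "lie_deriv (\<lambda>zs. 0) u zs = 0"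
  by (induction zs) auto

lemma lie_deriv_minus: "lie_deriv (\<lambda>zs. - D zs) u zs = - lie_deriv D u zs"
  using lie_deriv_linear[of "-1" D "\<lambda>_. 0"] by simp

lemma lie_deriv_diff: "lie_deriv (\<lambda>zs. D zs - E zs) u zs = lie_deriv D u zs - lie_deriv E u zs"
  using lie_deriv_add[of D "\<lambda>zs. - E zs"] by (simp add: lie_deriv_minus)

lemma lie_deriv_signed: "lie_deriv (\<lambda>zs. signed d (D zs)) u zs = signed d (lie_deriv D u zs)"
  by (cases d) (simp_all add: lie_deriv_minus)

text \<open>A Lie derivative at \<open>zs\<close> evaluates \<open>D\<close> only at lists as long
  as \<open>zs\<close>, so a sign that depends on the length passes through.\<close>

lemma lie_deriv_signed_parity: "lie_deriv (\<lambda>zs. signed (parity zs) (D zs)) u zs = signed (parity zs) (lie_deriv D u zs)"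
proof (induction zs arbitrary: D)
  case (Cons v zs)
  have "lie_deriv (\<lambda>zs. signed (1 + parity zs) (D (v # zs))) u zs = signed (1 + parity zs) (lie_deriv (\<lambda>zs. D (v # zs)) u zs)"
    using Cons[of "\<lambda>zs. signed 1 (D (v # zs))"] by (simp add: lie_deriv_minus signed_minus signed_Suc)
  then show ?case by (simp add: signed_add ac_simps)
qed (simp add: br_signed_left)

lemma lie_diff_linear: "lie_diff (\<lambda>zs. sL c (D zs) + E zs) zs = sL c (lie_diff D zs) + lie_diff E zs"
  by (induction zs arbitrary: D E)
    (simp_all add: lie_deriv_linear signed_add scale_right_distrib scale_signed)

lemma lie_diff_add: "lie_diff (\<lambda>zs. D zs + E zs) zs = lie_diff D zs + lie_diff E zs"
  using lie_diff_linear[of 1] by simp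

lemma lie_diff_zero [simp]: "lie_diff (\<lambda>zs. 0) zs = 0"
  by (induction zs) auto

lemma lie_diff_minus: "lie_diff (\<lambda>zs. - D zs) zs = - lie_diff D zs"
  using lie_diff_linear[of "-1" D "\<lambda>_. 0"] by simp

lemma lie_diff_signed: "lie_diff (\<lambda>zs. signed d (D zs)) zs = signed d (lie_diff D zs)"
  by (cases d) (simp_all add: lie_diff_minus)

text \<open>The differential at \<open>zs\<close> evaluates \<open>D\<close> at lists one shorter
  than \<open>zs\<close>, whence the \<open>1\<close> in the exponent. This shift is the source of
  the cancellation in \<open>lie_diff_lie_diff\<close>.\<close>

lemma lie_diff_signed_parity: "lie_diff (\<lambda>zs. signed (parity zs) (D zs)) zs = signed (1 + parity zs) (lie_diff D zs)"
proof (induction zs arbitrary: D)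
  case (Cons v zs)
  have "lie_diff (\<lambda>zs. signed (1 + parity zs) (D (v # zs))) zs = signed (parity zs) (lie_diff (\<lambda>zs. D (v # zs)) zs)"
    using Cons[of "\<lambda>zs. signed 1 (D (v # zs))"] by (simp add: lie_diff_minus signed_minus signed_Suc)
  then show ?case by (simp add: signed_add ac_simps lie_deriv_signed_parity)
qed simp

text \<open>Skew-symmetry and the recursion for \<open>delta\<close> are available at homogeneous
  arguments only. The Lie derivative looks at no other lists, since brackets of homogeneous elements
  are homogeneous.\<close>

lemma lie_deriv_cong:
  assumes "\<And>zs'. all_hom GL zs' \<Longrightarrow> length zs' = length zs \<Longrightarrow> D zs' = E zs'"
    and "all_hom GL (u # zs)"
  shows "lie_deriv D u zs = lie_deriv E u zs"
  using assms
proof (induction zs arbitrary: D E)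
  case (Cons v zs)
  have "lie_deriv (\<lambda>zs. D (v # zs)) u zs = lie_deriv (\<lambda>zs. E (v # zs)) u zs"
    by (rule Cons.IH) (use Cons.prems in auto)
  moreover have "D (pair_bracket u v # zs) = E (pair_bracket u v # zs)"
    by (rule Cons.prems(1)) (use Cons.prems(2) pair_bracket_hom in auto)
  ultimately show ?case by simp
qed simp

lemma lie_diff_cong:
  assumes "\<And>zs'. all_hom GL zs' \<Longrightarrow> Suc (length zs') = length zs \<Longrightarrow> D zs' = E zs'"
    and "all_hom GL zs"
  shows "lie_diff D zs = lie_diff E zs"
  using assms
proof (induction zs arbitrary: D E)
  case (Cons v zs)
  have "lie_diff (\<lambda>zs. D (v # zs)) zs = lie_diff (\<lambda>zs. E (v # zs)) zs"
    by (rule Cons.IH) (use Cons.prems in auto)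
  moreover have "lie_deriv D v zs = lie_deriv E v zs"
    by (rule lie_deriv_cong) (use Cons.prems in auto)
  ultimately show ?case by simp
qed simp

lemma slot_linear_pair_bracket_jacobi:
  assumes "slot_linear sL sL D" "snd u \<in> GL (fst u)" "snd v \<in> GL (fst v)" "snd w \<in> GL (fst w)"
  shows "D (pair_bracket u (pair_bracket v w) # zs) = D (pair_bracket (pair_bracket u v) w # zs) + signed (fst u * fst v) (D (pair_bracket v (pair_bracket u w) # zs))"
proof -
  \<comment> \<open>All three iterated brackets carry the same degree label, so the Jacobi identity
    is a linear combination within one slot.\<close>
  have "pair_bracket u (pair_bracket v w) = (fst u + fst v + fst w,
      sL (psign (fst u * fst v)) (snd (pair_bracket v (pair_bracket u w))) + snd (pair_bracket (pair_bracket u v) w))"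
    using jacobi[OF assms(2-4)] by (simp add: pair_bracket_def scale_psign ac_simps)
  then show ?thesis
    by (simp add: slot_linear_hd[OF assms(1)]) (simp add: pair_bracket_def scale_psign ac_simps)
qed

text \<open>At the empty list this is the Jacobi identity for a value of \<open>D\<close> and
  \<open>u\<close>, \<open>v\<close>. A further argument \<open>w\<close> contributes the Jacobi
  identity inside its own slot, and the induction hypothesis covers the terms that leave
  \<open>w\<close> alone. The mixed terms, where one of \<open>u\<close>, \<open>v\<close> is
  bracketed with \<open>w\<close> and the other acts further right, occur on both sides of the
  equation.\<close>

lemma lie_deriv_commute:
  assumes "slot_linear sL sL D" "snd u \<in> GL (fst u)" "snd v \<in> GL (fst v)" "all_hom GL zs"
  shows "lie_deriv (lie_deriv D u) v zs = signed (fst u * fst v) (lie_deriv (lie_deriv D v) u zs) + lie_deriv D (pair_bracket u v) zs"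
  using assms
proof (induction zs arbitrary: D)
  case Nil
  then show ?case using jacobi_right[of "snd u" "fst u" "snd v" "fst v" "D []"]
    by (simp add: pair_bracket_def ac_simps)
next
  case (Cons w zs)
  have IH: "lie_deriv (lie_deriv (\<lambda>zs. D (w # zs)) u) v zs
      = signed (fst u * fst v) (lie_deriv (lie_deriv (\<lambda>zs. D (w # zs)) v) u zs) + lie_deriv (\<lambda>zs. D (w # zs)) (pair_bracket u v) zs"
    by (rule Cons.IH) (use Cons.prems in \<open>auto intro: slot_linear_Cons\<close>)
  have J: "D (pair_bracket u (pair_bracket v w) # zs) = D (pair_bracket (pair_bracket u v) w # zs) + signed (fst u * fst v) (D (pair_bracket v (pair_bracket u w) # zs))"
    by (rule slot_linear_pair_bracket_jacobi) (use Cons.prems in auto)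
  obtain du dv dw where d: "fst u = du" "fst v = dv" "fst w = dw" by blast
  show ?case
    using IH J unfolding d
    by (cases du; cases dv; cases dw; simp add: lie_deriv_add lie_deriv_diff d)
qed

text \<open>Bracketing \<open>u\<close> with the head \<open>w\<close> yields the Cartan term of
  \<open>lie_diff\<close> along \<open>pair_bracket u w\<close>, which is exactly the correction in
  the commutation rule for the derivatives along \<open>u\<close> and \<open>w\<close>. No sign
  appears, because \<open>u\<close> acts from the right.\<close>

lemma lie_deriv_lie_diff:
  assumes "slot_linear sL sL D" "snd u \<in> GL (fst u)" "all_hom GL zs"
  shows "lie_deriv (lie_diff D) u zs = lie_diff (lie_deriv D u) zs"
  using assms
proof (induction zs arbitrary: D)
  case (Cons w zs)
  have "lie_deriv (lie_diff (\<lambda>zs. D (w # zs))) u zs = lie_diff (lie_deriv (\<lambda>zs. D (w # zs)) u) zs"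
    by (rule Cons.IH) (use Cons.prems in \<open>auto intro: slot_linear_Cons\<close>)
  moreover have "lie_deriv (lie_deriv D u) w zs = signed (fst u * fst w) (lie_deriv (lie_deriv D w) u zs) + lie_deriv D (pair_bracket u w) zs"
    by (rule lie_deriv_commute) (use Cons.prems in auto)
  ultimately show ?case
    by (simp add: lie_deriv_add lie_diff_add lie_deriv_signed_parity lie_deriv_signed lie_diff_signed signed_add ac_simps)
qed simp

text \<open>Cartan's formula, used at both levels, leaves two copies of
  \<open>lie_diff (lie_deriv D u)\<close>: one from the inner Cartan term, with exponent
  \<open>1 + parity zs\<close>, and one from commuting the outer derivative past
  \<open>lie_diff\<close>, with exponent \<open>parity zs\<close>. They cancel.\<close>

theorem lie_diff_lie_diff:
  assumes "slot_linear sL sL D" "all_hom GL zs"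
  shows "lie_diff (lie_diff D) zs = 0"
  using assms
proof (induction zs arbitrary: D)
  case (Cons u zs)
  have "lie_diff (lie_diff (\<lambda>zs. D (u # zs))) zs = 0"
    by (rule Cons.IH) (use Cons.prems in \<open>auto intro: slot_linear_Cons\<close>)
  moreover have "lie_deriv (lie_diff D) u zs = lie_diff (lie_deriv D u) zs"
    by (rule lie_deriv_lie_diff) (use Cons.prems in auto)
  ultimately show ?case
    by (simp add: lie_diff_add lie_diff_signed_parity signed_add signed_Suc)
qed simp

end

section \<open>Preservation of linearity, skew-symmetry and degree\<close>

definition slot_skew :: "(bit \<Rightarrow> 'l::ab_group_add set) \<Rightarrow> ((bit \<times> 'l) list \<Rightarrow> 'v::ab_group_add) \<Rightarrow> bool" where
  "slot_skew G D \<longleftrightarrow> (\<forall>zs u v zs'. all_hom G (zs @ u # v # zs') \<longrightarrow>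
     D (zs @ u # v # zs') = - signed (fst u * fst v) (D (zs @ v # u # zs')))"

lemma slot_skewD: "slot_skew G D \<Longrightarrow> all_hom G (zs @ u # v # zs') \<Longrightarrow>
    D (zs @ u # v # zs') = - signed (fst u * fst v) (D (zs @ v # u # zs'))"
  unfolding slot_skew_def by (elim allE) (erule mp)

lemma slot_skew_Cons: "slot_skew G D \<Longrightarrow> snd z \<in> G (fst z) \<Longrightarrow> slot_skew G (\<lambda>zs. D (z # zs))"
  unfolding slot_skew_def[of _ "\<lambda>zs. D (z # zs)"]
proof (intro allI impI)
  fix zs u v zs'
  assume "slot_skew G D" "snd z \<in> G (fst z)" "all_hom G (zs @ u # v # zs')"
  then show "D (z # zs @ u # v # zs') = - signed (fst u * fst v) (D (z # zs @ v # u # zs'))"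
    using slot_skewD[of G D "z # zs" u v zs'] by simp
qed

lemma slot_skew_hd: "slot_skew G D \<Longrightarrow> all_hom G (u # v # zs) \<Longrightarrow>
    D (u # v # zs) = - signed (fst u * fst v) (D (v # u # zs))"
  using slot_skewD[of G D "[]" u v zs] by simp

definition slot_degree :: "(bit \<Rightarrow> 'l set) \<Rightarrow> bit \<Rightarrow> ((bit \<times> 'l) list \<Rightarrow> 'l) \<Rightarrow> bool" where
  "slot_degree G j D \<longleftrightarrow> (\<forall>zs. all_hom G zs \<longrightarrow> D zs \<in> G (j + total_degree zs))"

lemma slot_degreeD: "slot_degree G j D \<Longrightarrow> all_hom G zs \<Longrightarrow> D zs \<in> G (j + total_degree zs)"
  unfolding slot_degree_def by blast

lemma slot_degree_Cons:
  assumes "slot_degree G j D" "snd z \<in> G (fst z)"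
  shows "slot_degree G (j + fst z) (\<lambda>zs. D (z # zs))"
  unfolding slot_degree_def using slot_degreeD[OF assms(1), of "z # _"] assms(2) by (auto simp: add.assoc)

context lie_superalgebra
begin

lemma pair_bracket_linear_right: "pair_bracket u (d, sL c x + y) = (fst u + d, sL c (br (snd u) x) + br (snd u) y)"
  and pair_bracket_linear_left: "pair_bracket (d, sL c x + y) v = (d + fst v, sL c (br x (snd v)) + br y (snd v))"
  by (simp_all add: pair_bracket_def br_add_left br_add_right br_scale_left br_scale_right)

lemma lie_deriv_slot_linear_eq:
  assumes "slot_linear sL sL D"
  shows "lie_deriv D u (zs @ (d, sL c x + y) # zs')
    = sL c (lie_deriv D u (zs @ (d, x) # zs')) + lie_deriv D u (zs @ (d, y) # zs')"
  using assms
proof (induction zs arbitrary: D)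
  case Nil
  show ?case
    by (simp add: slot_linear_hd[OF Nil] lie_deriv_linear pair_bracket_linear_right)
      (simp add: pair_bracket_def signed_add scale_right_distrib scale_signed)
next
  case (Cons w zs)
  have "slot_linear sL sL (\<lambda>zs. D (w # zs))" by (rule slot_linear_Cons[OF Cons.prems])
  note IH = Cons.IH[OF this]
  show ?case
    using slot_linearD[OF Cons.prems, of "pair_bracket u w # zs" d c x y zs'] IH
    by (simp add: signed_add scale_right_distrib scale_signed)
qed

lemma lie_deriv_linear_arg:
  assumes "slot_linear sL sL D"
  shows "lie_deriv D (d, sL c x + y) zs = sL c (lie_deriv D (d, x) zs) + lie_deriv D (d, y) zs"
  using assms
proof (induction zs arbitrary: D)
  case (Cons w zs)
  have "slot_linear sL sL (\<lambda>zs. D (w # zs))" by (rule slot_linear_Cons[OF Cons.prems])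
  note IH = Cons.IH[OF this]
  show ?case
    by (simp add: IH slot_linear_hd[OF Cons.prems] pair_bracket_linear_left)
      (simp add: pair_bracket_def signed_add scale_right_distrib scale_signed)
qed (simp add: br_add_right br_scale_right)

lemma lie_diff_slot_linear_eq:
  assumes "slot_linear sL sL D"
  shows "lie_diff D (zs @ (d, sL c x + y) # zs') = sL c (lie_diff D (zs @ (d, x) # zs')) + lie_diff D (zs @ (d, y) # zs')"
  using assms
proof (induction zs arbitrary: D)
  case Nil
  show ?case
    by (simp add: slot_linear_hd[OF Nil] lie_diff_linear lie_deriv_linear_arg[OF Nil] signed_add scale_right_distrib scale_signed)
next
  case (Cons w zs)
  have "slot_linear sL sL (\<lambda>zs. D (w # zs))" by (rule slot_linear_Cons[OF Cons.prems])
  note IH = Cons.IH[OF this]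
  show ?case
    by (simp add: IH lie_deriv_slot_linear_eq[OF Cons.prems] signed_add scale_right_distrib scale_signed)
qed

lemma lie_diff_slot_linear: "slot_linear sL sL D \<Longrightarrow> slot_linear sL sL (lie_diff D)"
  using lie_diff_slot_linear_eq unfolding slot_linear_def by blast

lemma lie_deriv_slot_degree_eq:
  assumes "slot_degree GL j D" "all_hom GL (u # zs)"
  shows "lie_deriv D u zs \<in> GL (j + fst u + total_degree zs)"
  using assms
proof (induction zs arbitrary: j D)
  case Nil
  then show ?case using slot_degreeD[OF Nil(1), of "[]"] br_even[of "D []" j "snd u" "fst u"] by simp
next
  case (Cons w zs)
  have "slot_degree GL (j + fst w) (\<lambda>zs. D (w # zs))" by (rule slot_degree_Cons) (use Cons.prems in auto)
  then have "lie_deriv (\<lambda>zs. D (w # zs)) u zs \<in> GL (j + fst w + fst u + total_degree zs)"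
    by (rule Cons.IH) (use Cons.prems in auto)
  moreover have "D (pair_bracket u w # zs) \<in> GL (j + total_degree (pair_bracket u w # zs))"
    by (rule slot_degreeD[OF Cons.prems(1)]) (use Cons.prems pair_bracket_hom in auto)
  ultimately show ?case by (auto simp: ac_simps intro!: G_add G_signed)
qed

lemma lie_diff_slot_degree_eq:
  assumes "slot_degree GL j D" "all_hom GL zs"
  shows "lie_diff D zs \<in> GL (j + total_degree zs)"
  using assms
proof (induction zs arbitrary: j D)
  case (Cons w zs)
  have "slot_degree GL (j + fst w) (\<lambda>zs. D (w # zs))" by (rule slot_degree_Cons) (use Cons.prems in auto)
  then have "lie_diff (\<lambda>zs. D (w # zs)) zs \<in> GL (j + fst w + total_degree zs)"
    by (rule Cons.IH) (use Cons.prems in auto)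
  moreover have "lie_deriv D w zs \<in> GL (j + fst w + total_degree zs)"
    by (rule lie_deriv_slot_degree_eq) (use Cons.prems in auto)
  ultimately show ?case by (auto simp: ac_simps intro!: G_add G_signed)
qed simp

lemma lie_diff_slot_degree: "slot_degree GL j D \<Longrightarrow> slot_degree GL j (lie_diff D)"
  unfolding slot_degree_def[of _ _ "lie_diff D"] using lie_diff_slot_degree_eq by blast

lemma lie_deriv_slot_skew_eq:
  assumes "slot_skew GL D" "all_hom GL (u # zs @ v # w # zs')"
  shows "lie_deriv D u (zs @ v # w # zs') = - signed (fst v * fst w) (lie_deriv D u (zs @ w # v # zs'))"
  using assms
proof (induction zs arbitrary: D)
  case Nil
  \<comment> \<open>Exchanging \<open>v\<close> and \<open>w\<close> interchanges the roles of the
    two bracket terms; skew-symmetry of \<open>D\<close> matches each with its counterpart by moving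
    the whole bracket past the other argument.\<close>
  have 1: "D (pair_bracket u v # w # zs') = - signed ((fst u + fst v) * fst w) (D (w # pair_bracket u v # zs'))"
    using slot_skew_hd[OF Nil(1), of "pair_bracket u v" w zs'] Nil(2) pair_bracket_hom by simp
  have 2: "D (v # pair_bracket u w # zs') = - signed (fst v * (fst u + fst w)) (D (pair_bracket u w # v # zs'))"
    using slot_skew_hd[OF Nil(1), of v "pair_bracket u w" zs'] Nil(2) pair_bracket_hom by simp
  have 3: "lie_deriv (\<lambda>zs. D (v # w # zs)) u zs' = - signed (fst v * fst w) (lie_deriv (\<lambda>zs. D (w # v # zs)) u zs')"
  proof -
    have "lie_deriv (\<lambda>zs. D (v # w # zs)) u zs' = lie_deriv (\<lambda>zs. - signed (fst v * fst w) (D (w # v # zs))) u zs'"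
      by (rule lie_deriv_cong, rule slot_skew_hd[OF Nil(1)]) (use Nil in auto)
    then show ?thesis by (simp add: lie_deriv_minus lie_deriv_signed)
  qed
  obtain du dv dw where d: "fst u = du" "fst v = dv" "fst w = dw" by blast
  show ?case using 1 2 3 unfolding d
    by (cases du; cases dv; cases dw; simp add: d)
next
  case (Cons x zs)
  have "slot_skew GL (\<lambda>zs. D (x # zs))" by (rule slot_skew_Cons) (use Cons.prems in auto)
  then have IH: "lie_deriv (\<lambda>zs. D (x # zs)) u (zs @ v # w # zs')
      = - signed (fst v * fst w) (lie_deriv (\<lambda>zs. D (x # zs)) u (zs @ w # v # zs'))"
    by (rule Cons.IH) (use Cons.prems in auto)
  have "D ((pair_bracket u x # zs) @ v # w # zs') = - signed (fst v * fst w) (D ((pair_bracket u x # zs) @ w # v # zs'))"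
    by (rule slot_skewD[OF Cons.prems(1)]) (use Cons.prems pair_bracket_hom in auto)
  then show ?case by (simp add: IH signed_add signed_minus ac_simps)
qed

lemma pair_bracket_skew:
  assumes "slot_linear sL sL D" "snd u \<in> GL (fst u)" "snd v \<in> GL (fst v)"
  shows "D (pair_bracket u v # zs) = - signed (fst u * fst v) (D (pair_bracket v u # zs))"
proof -
  \<comment> \<open>The summand \<open>0\<close> gives the entry the shape that
    \<open>slot_linear\<close> expects.\<close>
  have "pair_bracket u v = (fst v + fst u, sL (- psign (fst u * fst v)) (br (snd v) (snd u)) + 0)"
    using skew[OF assms(2,3)] by (simp add: pair_bracket_def scale_psign ac_simps)
  moreover have "D ((fst v + fst u, 0) # zs) = 0"
    using slot_linear_hd[OF assms(1), of "fst v + fst u" 1 0 0 zs] by simp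
  ultimately show ?thesis
    using slot_linear_hd[OF assms(1), of "fst v + fst u" "- psign (fst u * fst v)" "br (snd v) (snd u)" 0 zs]
    by (simp add: scale_psign pair_bracket_def add.commute)
qed

text \<open>Two unfoldings at the head give a differential with \<open>v\<close> and
  \<open>w\<close> inserted, a value of \<open>D\<close> at their bracket, and two Lie derivatives,
  along \<open>w\<close> with \<open>v\<close> inserted and along \<open>v\<close> with
  \<open>w\<close> inserted. The first is skew because \<open>D\<close> is, the second because the
  bracket is, and the last two change places.\<close>

lemma lie_diff_slot_skew_eq:
  assumes "slot_linear sL sL D" "slot_skew GL D" "all_hom GL (zs @ v # w # zs')"
  shows "lie_diff D (zs @ v # w # zs') = - signed (fst v * fst w) (lie_diff D (zs @ w # v # zs'))"
  using assms
proof (induction zs arbitrary: D)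
  case Nil
  have 1: "D (pair_bracket v w # zs') = - signed (fst v * fst w) (D (pair_bracket w v # zs'))"
    using pair_bracket_skew[OF Nil(1), of v w zs'] Nil(3) by simp
  have 2: "lie_diff (\<lambda>zs. D (v # w # zs)) zs' = - signed (fst v * fst w) (lie_diff (\<lambda>zs. D (w # v # zs)) zs')"
  proof -
    have "lie_diff (\<lambda>zs. D (v # w # zs)) zs' = lie_diff (\<lambda>zs. - signed (fst v * fst w) (D (w # v # zs))) zs'"
      by (rule lie_diff_cong, rule slot_skew_hd[OF Nil(2)]) (use Nil in auto)
    then show ?thesis by (simp add: lie_diff_minus lie_diff_signed)
  qed
  obtain dv dw p where d: "fst v = dv" "fst w = dw" "parity zs' = p" by blast
  show ?case using 1 2 unfolding d
    by (cases dv; cases dw; cases p; simp add: d)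
next
  case (Cons x zs)
  have IH: "lie_diff (\<lambda>zs. D (x # zs)) (zs @ v # w # zs')
      = - signed (fst v * fst w) (lie_diff (\<lambda>zs. D (x # zs)) (zs @ w # v # zs'))"
    by (rule Cons.IH) (use Cons.prems in \<open>auto intro: slot_skew_Cons slot_linear_Cons\<close>)
  have "lie_deriv D x (zs @ v # w # zs') = - signed (fst v * fst w) (lie_deriv D x (zs @ w # v # zs'))"
    by (rule lie_deriv_slot_skew_eq[OF Cons.prems(2)]) (use Cons.prems in auto)
  then show ?case by (simp add: IH signed_add signed_minus ac_simps)
qed

end

section \<open>Symbols\<close>

context supercommutative_superalgebra
begin

lemma superderivation_iff:
  "superderivation sA GA d D \<longleftrightarrow> Vector_Spaces.linear sA sA D \<and> (\<forall>i. \<forall>a\<in>GA i. D a \<in> GA (d + i)) \<and>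
     (\<forall>i j. \<forall>a\<in>GA i. \<forall>b\<in>GA j. D (a * b) = D a * b + signed (i * d) (a * D b))"
  by (simp add: superderivation_def scale_psign)

lemma superderivation_linear:
  "superderivation sA GA d D \<Longrightarrow> Vector_Spaces.linear sA sA D"
  by (simp add: superderivation_def)

lemma linear_combination:
  assumes "Vector_Spaces.linear sA sA D" "Vector_Spaces.linear sA sA E"
  shows "Vector_Spaces.linear sA sA (\<lambda>a. sA c (D a) + E a)"
proof -
  interpret D: Vector_Spaces.linear sA sA D by fact
  interpret E: Vector_Spaces.linear sA sA E by fact
  show ?thesis
    by unfold_locales (simp_all add: D.add E.add D.scale E.scale scale_right_distrib ac_simps)
qed

lemma linear_zero: "Vector_Spaces.linear sA sA (\<lambda>a. 0)"
  by unfold_locales simp_all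

lemma linear_add:
  "Vector_Spaces.linear sA sA D \<Longrightarrow> Vector_Spaces.linear sA sA E \<Longrightarrow> Vector_Spaces.linear sA sA (\<lambda>a. D a + E a)"
  using linear_combination[of D E 1] by simp

lemma superderivation_zero: "superderivation sA GA d (\<lambda>a. 0)"
  by (simp add: superderivation_iff linear_zero)

lemma superderivation_add:
  "superderivation sA GA d D \<Longrightarrow> superderivation sA GA d E \<Longrightarrow> superderivation sA GA d (\<lambda>a. D a + E a)"
  by (auto simp: superderivation_iff linear_add G_add signed_add algebra_simps)

lemma superderivation_signed:
  assumes "superderivation sA GA d D"
  shows "superderivation sA GA d (\<lambda>a. signed e (D a))"
proof (cases e)
  case zero then show ?thesis using assms by simp
next
  case one
  moreover have "Vector_Spaces.linear sA sA (\<lambda>a. - D a)"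
    using linear_combination[OF superderivation_linear[OF assms] linear_zero, of "-1"] by simp
  ultimately show ?thesis using assms
    by (auto simp: superderivation_iff G_minus signed_minus algebra_simps)
qed

text \<open>In the product rule the mixed terms \<open>D a * E b\<close> and
  \<open>E a * D b\<close> cancel. The supercommutator with \<open>\<rho> u\<close> is the base case
  of \<open>lie_deriv_symbol\<close>.\<close>

lemma superderivation_commutator:
  assumes D: "superderivation sA GA d D" and E: "superderivation sA GA e E"
  shows "superderivation sA GA (d + e) (\<lambda>a. D (E a) - signed (d * e) (E (D a)))"
proof -
  interpret D: Vector_Spaces.linear sA sA D using D by (simp add: superderivation_def)
  interpret E: Vector_Spaces.linear sA sA E using E by (simp add: superderivation_def)
  have degD: "D a \<in> GA (d + i)" and degE: "E a \<in> GA (e + i)" if "a \<in> GA i" for a i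
    using D E that by (simp_all add: superderivation_iff)
  have D_mult: "D (a * b) = D a * b + signed (i * d) (a * D b)"
    and E_mult: "E (a * b) = E a * b + signed (i * e) (a * E b)" if "a \<in> GA i" "b \<in> GA j" for a b i j
    using D E that by (simp_all add: superderivation_iff)
  have signedD: "D (signed f a) = signed f (D a)" and signedE: "E (signed f a) = signed f (E a)" for f a
    by (cases f; simp add: D.neg E.neg)+
  have "Vector_Spaces.linear sA sA (\<lambda>a. D (E a) - signed (d * e) (E (D a)))"
    by unfold_locales (simp_all add: D.add E.add D.scale E.scale signed_add scale_signed scale_right_diff_distrib)
  moreover have "D (E a) - signed (d * e) (E (D a)) \<in> GA (d + e + i)" if a: "a \<in> GA i" for a i
    using degD[OF degE[OF a]] degE[OF degD[OF a]] by (auto simp: ac_simps intro!: G_diff G_signed)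
  moreover have "D (E (a * b)) - signed (d * e) (E (D (a * b)))
      = (D (E a) - signed (d * e) (E (D a))) * b + signed (i * (d + e)) (a * (D (E b) - signed (d * e) (E (D b))))"
    if a: "a \<in> GA i" and b: "b \<in> GA j" for a b i j
  proof -
    have 1: "D (E (a * b)) = D (E a) * b + signed ((e + i) * d) (E a * D b)
        + signed (i * e) (D a * E b + signed (i * d) (a * D (E b)))"
      by (simp add: E_mult[OF a b] D.add signedD D_mult[OF degE[OF a] b] D_mult[OF a degE[OF b]])
    have 2: "E (D (a * b)) = E (D a) * b + signed ((d + i) * e) (D a * E b)
        + signed (i * d) (E a * D b + signed (i * e) (a * E (D b)))"
      by (simp add: D_mult[OF a b] E.add signedE E_mult[OF degD[OF a] b] E_mult[OF a degD[OF b]])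
    show ?thesis unfolding 1 2
      by (cases d; cases e; cases i; simp add: algebra_simps)
  qed
  ultimately show ?thesis unfolding superderivation_iff by blast
qed

end

section \<open>Symbols of the Lie derivative and of the differential\<close>

context lie_rinehart_superalgebra
begin

lemma act_add_left: "act (a + b) x = act a x + act b x"
  and act_zero_left [simp]: "act 0 x = 0"
  and act_minus_left: "act (- a) x = - act a x"
  and act_diff_left: "act (a - b) x = act a x - act b x"
proof -
  interpret l: Vector_Spaces.linear sA sL "\<lambda>a. act a x" by (rule act_linear_left)
  show "act (a + b) x = act a x + act b x" "act 0 x = 0"
    "act (- a) x = - act a x" "act (a - b) x = act a x - act b x"
    by (simp_all add: l.add l.scale l.zero l.neg l.diff)
qed

lemma act_add_right: "act a (x + y) = act a x + act a y"
  and act_zero_right [simp]: "act a 0 = 0"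
  and act_minus_right: "act a (- x) = - act a x"
  and act_diff_right: "act a (x - y) = act a x - act a y"
proof -
  interpret l: Vector_Spaces.linear sL sL "act a" by (rule act_linear_right)
  show "act a (x + y) = act a x + act a y" "act a 0 = 0"
    "act a (- x) = - act a x" "act a (x - y) = act a x - act a y"
    by (simp_all add: l.add l.scale l.zero l.neg l.diff)
qed

lemma act_signed_left: "act (signed d a) x = signed d (act a x)" and act_signed_right: "act a (signed d x) = signed d (act a x)"
  by (cases d; simp add: act_minus_left act_minus_right)+

lemma rho_combination: "\<rho> (sL c x + y) a = sA c (\<rho> x a) + \<rho> y a"
proof -
  interpret l: Vector_Spaces.linear sL sA "\<lambda>x. \<rho> x a" by (rule rho_linear)
  show ?thesis by (simp add: l.add l.scale)
qed

lemma rho_degree: "x \<in> GL i \<Longrightarrow> a \<in> GA j \<Longrightarrow> \<rho> x a \<in> GA (i + j)"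
  using rho_even[of x i] by (simp add: superderivation_def)

lemma rho_linear_hom: "Vector_Spaces.linear sA sA (\<rho> x)"
proof -
  let ?c = "\<lambda>d. component GL d x"
  have "Vector_Spaces.linear sA sA (\<lambda>a. \<rho> (?c 0) a + \<rho> (?c 1) a)"
    using rho_even[OF L.component_spec(1), of 0 x] rho_even[OF L.component_spec(1), of 1 x]
    by (intro A.linear_add) (simp_all add: superderivation_def)
  moreover have "\<rho> (?c 0) a + \<rho> (?c 1) a = \<rho> x a" for a
    using rho_combination[of 1 "?c 0" "?c 1" a] by (simp add: L.component_decomp)
  ultimately show ?thesis by simp
qed

lemma br_act_right:
  "x \<in> GL i \<Longrightarrow> a \<in> GA j \<Longrightarrow> br x (act a y) = act (\<rho> x a) y + signed (i * j) (act a (br x y))"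
  using br_act[of x i a j y] by (simp add: L.scale_psign mult.commute)

text \<open>The Leibniz rule on the side where the values of \<open>D\<close> stand in
  \<open>lie_deriv\<close>; it follows from the given one by skew-symmetry, used before and
  after.\<close>

lemma br_act_left:
  assumes x: "x \<in> GL i" and a: "a \<in> GA j" and y: "y \<in> GL k"
  shows "br (act a y) x = act a (br y x) - signed ((j + k) * i) (act (\<rho> x a) y)"
proof -
  have "br (act a y) x = - signed ((j + k) * i) (br x (act a y))"
    by (rule L.skew) (use assms act_degree in auto)
  moreover have "br x y = - signed (i * k) (br y x)"
    by (rule L.skew) (use assms in auto)
  ultimately show ?thesis
    by (cases i; cases j; cases k; simp add: br_act_right[OF x a] act_minus_right)
qed

text \<open>In both recursions \<open>j\<close> is the degree of the map with symbol \<open>\<sigma>\<close>; it grows by \<open>|u|\<close> when \<open>u\<close> is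
  inserted.\<close>

primrec lie_deriv_symbol :: "bit \<Rightarrow> ((bit \<times> 'l) list \<Rightarrow> 'a \<Rightarrow> 'a) \<Rightarrow> bit \<times> 'l \<Rightarrow> (bit \<times> 'l) list \<Rightarrow> 'a \<Rightarrow> 'a" where
  "lie_deriv_symbol j \<sigma> u [] = (\<lambda>a. \<sigma> [] (\<rho> (snd u) a) - signed (j * fst u) (\<rho> (snd u) (\<sigma> [] a)))"
| "lie_deriv_symbol j \<sigma> u (v # zs) = (\<lambda>a. \<sigma> (L.pair_bracket u v # zs) a
      + signed (fst u * fst v) (lie_deriv_symbol (j + fst v) (\<lambda>zs. \<sigma> (v # zs)) u zs a))"

primrec lie_diff_symbol :: "bit \<Rightarrow> ((bit \<times> 'l) list \<Rightarrow> 'l) \<Rightarrow> ((bit \<times> 'l) list \<Rightarrow> 'a \<Rightarrow> 'a) \<Rightarrow>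
    (bit \<times> 'l) list \<Rightarrow> 'a \<Rightarrow> 'a" where
  "lie_diff_symbol j D \<sigma> [] = \<rho> (D [])"
| "lie_diff_symbol j D \<sigma> (u # zs) = (\<lambda>a. lie_diff_symbol (j + fst u) (\<lambda>zs. D (u # zs)) (\<lambda>zs. \<sigma> (u # zs)) zs a
      + signed (1 + parity zs) (lie_deriv_symbol j \<sigma> u zs a))"

definition graded_der :: "bit \<Rightarrow> ((bit \<times> 'l) list \<Rightarrow> 'a \<Rightarrow> 'a) \<Rightarrow> bool" where
  "graded_der j \<sigma> \<longleftrightarrow> (\<forall>zs. all_hom GL zs \<longrightarrow> superderivation sA GA (j + total_degree zs) (\<sigma> zs))"

lemma graded_derD: "graded_der j \<sigma> \<Longrightarrow> all_hom GL zs \<Longrightarrow> superderivation sA GA (j + total_degree zs) (\<sigma> zs)"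
  unfolding graded_der_def by blast

lemma graded_der_Cons:
  assumes "graded_der j \<sigma>" "snd z \<in> GL (fst z)"
  shows "graded_der (j + fst z) (\<lambda>zs. \<sigma> (z # zs))"
  unfolding graded_der_def using graded_derD[OF assms(1), of "z # _"] assms(2) by (auto simp: add.assoc)

text \<open>The label of the last entry has to follow the degree of \<open>act a y\<close>, so
  \<open>y\<close> is homogeneous here, whereas \<open>is_symbol\<close> admits every
  \<open>y\<close>.\<close>

definition has_symbol :: "bit \<Rightarrow> ((bit \<times> 'l) list \<Rightarrow> 'l) \<Rightarrow> ((bit \<times> 'l) list \<Rightarrow> 'a \<Rightarrow> 'a) \<Rightarrow> bool" where
  "has_symbol j D \<sigma> \<longleftrightarrow> (\<forall>zs a e d y. all_hom GL zs \<longrightarrow> a \<in> GA e \<longrightarrow> y \<in> GL d \<longrightarrow>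
     D (zs @ [(e + d, act a y)]) =
       signed (e * (j + total_degree zs)) (act a (D (zs @ [(d, y)]))) + act (\<sigma> zs a) y)"

lemma has_symbolD: "has_symbol j D \<sigma> \<Longrightarrow> all_hom GL zs \<Longrightarrow> a \<in> GA e \<Longrightarrow> y \<in> GL d \<Longrightarrow>
   D (zs @ [(e + d, act a y)]) = signed (e * (j + total_degree zs)) (act a (D (zs @ [(d, y)]))) + act (\<sigma> zs a) y"
  unfolding has_symbol_def by (elim allE) (drule mp, assumption)+

lemma has_symbol_Cons:
  assumes "has_symbol j D \<sigma>" "snd z \<in> GL (fst z)"
  shows "has_symbol (j + fst z) (\<lambda>zs. D (z # zs)) (\<lambda>zs. \<sigma> (z # zs))"
  unfolding has_symbol_def
proof (intro allI impI)
  fix zs a e d y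
  assume "all_hom GL zs" "a \<in> GA e" "y \<in> GL d"
  then show "D (z # zs @ [(e + d, act a y)]) =
       signed (e * (j + fst z + total_degree zs)) (act a (D (z # zs @ [(d, y)]))) + act (\<sigma> (z # zs) a) y"
    using has_symbolD[OF assms(1), of "z # zs" a e y d] assms(2) by (simp add: add.assoc)
qed

lemma lie_deriv_symbol_graded_der_eq:
  assumes "graded_der j \<sigma>" "all_hom GL (u # zs)"
  shows "superderivation sA GA (j + fst u + total_degree zs) (lie_deriv_symbol j \<sigma> u zs)"
  using assms
proof (induction zs arbitrary: j \<sigma>)
  case Nil
  then show ?case
    using A.superderivation_commutator[of j "\<sigma> []" "fst u" "\<rho> (snd u)"] graded_derD[OF Nil(1), of "[]"]
      rho_even by simp
next
  case (Cons w zs)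
  have "graded_der (j + fst w) (\<lambda>zs. \<sigma> (w # zs))" by (rule graded_der_Cons) (use Cons.prems in auto)
  then have 1: "superderivation sA GA (j + fst w + fst u + total_degree zs) (lie_deriv_symbol (j + fst w) (\<lambda>zs. \<sigma> (w # zs)) u zs)"
    by (rule Cons.IH) (use Cons.prems in auto)
  have 2: "superderivation sA GA (j + total_degree (L.pair_bracket u w # zs)) (\<sigma> (L.pair_bracket u w # zs))"
    by (rule graded_derD[OF Cons.prems(1)]) (use Cons.prems L.pair_bracket_hom in auto)
  show ?case
    using A.superderivation_add[OF _ A.superderivation_signed[OF 1]] 2 by (simp add: ac_simps)
qed

lemma lie_diff_symbol_graded_der_eq:
  assumes "graded_der j \<sigma>" "slot_degree GL j D" "all_hom GL zs"
  shows "superderivation sA GA (j + total_degree zs) (lie_diff_symbol j D \<sigma> zs)"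
  using assms
proof (induction zs arbitrary: j \<sigma> D)
  case Nil
  then show ?case using slot_degreeD[OF Nil(2), of "[]"] rho_even by simp
next
  case (Cons w zs)
  have "graded_der (j + fst w) (\<lambda>zs. \<sigma> (w # zs))" by (rule graded_der_Cons) (use Cons.prems in auto)
  moreover have "slot_degree GL (j + fst w) (\<lambda>zs. D (w # zs))" by (rule slot_degree_Cons) (use Cons.prems in auto)
  ultimately have 1: "superderivation sA GA (j + fst w + total_degree zs)
      (lie_diff_symbol (j + fst w) (\<lambda>zs. D (w # zs)) (\<lambda>zs. \<sigma> (w # zs)) zs)"
    by (rule Cons.IH) (use Cons.prems in auto)
  have 2: "superderivation sA GA (j + fst w + total_degree zs) (lie_deriv_symbol j \<sigma> w zs)"
    by (rule lie_deriv_symbol_graded_der_eq) (use Cons.prems in auto)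
  show ?case
    using A.superderivation_add[OF 1 A.superderivation_signed[OF 2]] by (simp add: ac_simps)
qed

lemma lie_deriv_symbol_linear:
  assumes "\<And>zs. Vector_Spaces.linear sA sA (\<sigma> zs)"
  shows "lie_deriv_symbol j (\<lambda>zs a. sA c (\<sigma> zs a) + \<tau> zs a) u zs a = sA c (lie_deriv_symbol j \<sigma> u zs a) + lie_deriv_symbol j \<tau> u zs a"
  using assms
proof (induction zs arbitrary: j \<sigma> \<tau>)
  case Nil
  interpret l: Vector_Spaces.linear sA sA "\<rho> (snd u)" by (rule rho_linear_hom)
  show ?case by (simp add: l.add l.scale signed_add A.scale_signed A.scale_right_diff_distrib)
next
  case (Cons w zs)
  show ?case
    by (simp add: Cons.IH[of "\<lambda>zs. \<sigma> (w # zs)"] Cons.prems signed_add A.scale_signed A.scale_right_distrib)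
qed

lemma lie_deriv_symbol_linear_arg:
  assumes "\<And>a. slot_linear sL sA (\<lambda>zs. \<sigma> zs a)" "\<And>zs. Vector_Spaces.linear sA sA (\<sigma> zs)"
  shows "lie_deriv_symbol j \<sigma> (d, sL c x + y) zs a = sA c (lie_deriv_symbol j \<sigma> (d, x) zs a) + lie_deriv_symbol j \<sigma> (d, y) zs a"
  using assms
proof (induction zs arbitrary: j \<sigma>)
  case Nil
  interpret l: Vector_Spaces.linear sA sA "\<sigma> []" by (rule Nil(2))
  show ?case
    by (simp add: l.add l.scale signed_add A.scale_signed A.scale_right_diff_distrib rho_combination)
next
  case (Cons w zs)
  have "lie_deriv_symbol (j + fst w) (\<lambda>zs. \<sigma> (w # zs)) (d, sL c x + y) zs a
    = sA c (lie_deriv_symbol (j + fst w) (\<lambda>zs. \<sigma> (w # zs)) (d, x) zs a) + lie_deriv_symbol (j + fst w) (\<lambda>zs. \<sigma> (w # zs)) (d, y) zs a"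
    by (rule Cons.IH) (use Cons.prems in \<open>auto intro: slot_linear_Cons\<close>)
  then show ?case
    by (simp add: slot_linear_hd[OF Cons.prems(1)] L.pair_bracket_linear_left)
      (simp add: L.pair_bracket_def signed_add A.scale_right_distrib A.scale_signed)
qed

lemma lie_deriv_symbol_slot_linear_eq:
  assumes "\<And>a. slot_linear sL sA (\<lambda>zs. \<sigma> zs a)" "\<And>zs. Vector_Spaces.linear sA sA (\<sigma> zs)"
  shows "lie_deriv_symbol j \<sigma> u (zs @ (d, sL c x + y) # zs') a
    = sA c (lie_deriv_symbol j \<sigma> u (zs @ (d, x) # zs') a) + lie_deriv_symbol j \<sigma> u (zs @ (d, y) # zs') a"
  using assms
proof (induction zs arbitrary: j \<sigma>)
  case Nil
  have "(\<lambda>zs a. \<sigma> ((d, sL c x + y) # zs) a)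
      = (\<lambda>zs a. sA c (\<sigma> ((d, x) # zs) a) + \<sigma> ((d, y) # zs) a)"
    by (intro ext slot_linear_hd Nil)
  then have 1: "lie_deriv_symbol (j + d) (\<lambda>zs. \<sigma> ((d, sL c x + y) # zs)) u zs' a
      = sA c (lie_deriv_symbol (j + d) (\<lambda>zs. \<sigma> ((d, x) # zs)) u zs' a) + lie_deriv_symbol (j + d) (\<lambda>zs. \<sigma> ((d, y) # zs)) u zs' a"
    using lie_deriv_symbol_linear[of "\<lambda>zs. \<sigma> ((d, x) # zs)"] Nil(2) by simp
  show ?case
    by (simp add: 1 slot_linear_hd[OF Nil(1)] L.pair_bracket_linear_right)
      (simp add: L.pair_bracket_def signed_add A.scale_right_distrib A.scale_signed)
next
  case (Cons w zs)
  have "lie_deriv_symbol (j + fst w) (\<lambda>zs. \<sigma> (w # zs)) u (zs @ (d, sL c x + y) # zs') a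
    = sA c (lie_deriv_symbol (j + fst w) (\<lambda>zs. \<sigma> (w # zs)) u (zs @ (d, x) # zs') a)
      + lie_deriv_symbol (j + fst w) (\<lambda>zs. \<sigma> (w # zs)) u (zs @ (d, y) # zs') a"
    by (rule Cons.IH) (use Cons.prems in \<open>auto intro: slot_linear_Cons\<close>)
  then show ?case
    using slot_linearD[OF Cons.prems(1), of "L.pair_bracket u w # zs" d c x y zs' a]
    by (simp add: signed_add A.scale_right_distrib A.scale_signed)
qed

lemma lie_diff_symbol_linear:
  assumes "\<And>zs. Vector_Spaces.linear sA sA (\<sigma> zs)"
  shows "lie_diff_symbol j (\<lambda>zs. sL c (D zs) + E zs) (\<lambda>zs a. sA c (\<sigma> zs a) + \<tau> zs a) zs a
    = sA c (lie_diff_symbol j D \<sigma> zs a) + lie_diff_symbol j E \<tau> zs a"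
  using assms
proof (induction zs arbitrary: j \<sigma> \<tau> D E)
  case (Cons w zs)
  show ?case
    by (simp add: Cons.IH[of "\<lambda>zs. \<sigma> (w # zs)"] Cons.prems lie_deriv_symbol_linear signed_add A.scale_signed A.scale_right_distrib)
qed (simp add: rho_combination)

lemma lie_diff_symbol_slot_linear_eq:
  assumes "slot_linear sL sL D" "\<And>a. slot_linear sL sA (\<lambda>zs. \<sigma> zs a)" "\<And>zs. Vector_Spaces.linear sA sA (\<sigma> zs)"
  shows "lie_diff_symbol j D \<sigma> (zs @ (d, sL c x + y) # zs') a
    = sA c (lie_diff_symbol j D \<sigma> (zs @ (d, x) # zs') a) + lie_diff_symbol j D \<sigma> (zs @ (d, y) # zs') a"
  using assms
proof (induction zs arbitrary: j D \<sigma>)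
  case Nil
  have "(\<lambda>zs a. \<sigma> ((d, sL c x + y) # zs) a)
      = (\<lambda>zs a. sA c (\<sigma> ((d, x) # zs) a) + \<sigma> ((d, y) # zs) a)"
    by (intro ext slot_linear_hd Nil)
  moreover have "(\<lambda>zs. D ((d, sL c x + y) # zs)) = (\<lambda>zs. sL c (D ((d, x) # zs)) + D ((d, y) # zs))"
    by (intro ext slot_linear_hd Nil)
  ultimately have 1: "lie_diff_symbol (j + d) (\<lambda>zs. D ((d, sL c x + y) # zs)) (\<lambda>zs. \<sigma> ((d, sL c x + y) # zs)) zs' a
      = sA c (lie_diff_symbol (j + d) (\<lambda>zs. D ((d, x) # zs)) (\<lambda>zs. \<sigma> ((d, x) # zs)) zs' a)
        + lie_diff_symbol (j + d) (\<lambda>zs. D ((d, y) # zs)) (\<lambda>zs. \<sigma> ((d, y) # zs)) zs' a"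
    using lie_diff_symbol_linear[of "\<lambda>zs. \<sigma> ((d, x) # zs)"] Nil(3) by simp
  show ?case
    by (simp add: 1 lie_deriv_symbol_linear_arg[OF Nil(2,3)] signed_add A.scale_right_distrib A.scale_signed)
next
  case (Cons w zs)
  have "lie_diff_symbol (j + fst w) (\<lambda>zs. D (w # zs)) (\<lambda>zs. \<sigma> (w # zs)) (zs @ (d, sL c x + y) # zs') a
    = sA c (lie_diff_symbol (j + fst w) (\<lambda>zs. D (w # zs)) (\<lambda>zs. \<sigma> (w # zs)) (zs @ (d, x) # zs') a)
      + lie_diff_symbol (j + fst w) (\<lambda>zs. D (w # zs)) (\<lambda>zs. \<sigma> (w # zs)) (zs @ (d, y) # zs') a"
    by (rule Cons.IH) (use Cons.prems in \<open>auto intro: slot_linear_Cons\<close>)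
  then show ?case
    by (simp add: lie_deriv_symbol_slot_linear_eq[OF Cons.prems(2,3)] signed_add A.scale_right_distrib A.scale_signed)
qed

text \<open>At the empty list two pairs of terms cancel: those with \<open>\<rho> (snd u) a\<close>
  acting on \<open>D [(d, y)]\<close>, and those with \<open>\<sigma> [] a\<close> acting on the
  bracket of \<open>u\<close> and \<open>y\<close>. What remains in front of \<open>y\<close> is the
  supercommutator of \<open>\<sigma> []\<close> and \<open>\<rho> (snd u)\<close>; this is where the
  base case of \<open>lie_deriv_symbol\<close> comes from.\<close>

lemma lie_deriv_has_symbol_eq:
  assumes "slot_linear sL sL D" "slot_degree GL j D" "graded_der j \<sigma>" "has_symbol j D \<sigma>" "all_hom GL (u # zs)"
    and a: "a \<in> GA e" and y: "y \<in> GL d"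
  shows "L.lie_deriv D u (zs @ [(e + d, act a y)]) =
       signed (e * (j + fst u + total_degree zs)) (act a (L.lie_deriv D u (zs @ [(d, y)]))) + act (lie_deriv_symbol j \<sigma> u zs a) y"
  using assms(1-5)
proof (induction zs arbitrary: j D \<sigma>)
  case Nil
  let ?k = "fst u" and ?u = "snd u"
  have u: "?u \<in> GL ?k" using Nil by simp
  have D0: "D [(f, x + z)] = D [(f, x)] + D [(f, z)]" for f x z
    using slot_linear_hd[OF Nil(1), of f 1 x z "[]"] by simp
  have Dsg: "D [(f, signed g x)] = signed g (D [(f, x)])" for f g x
    using slot_linear_hd[OF Nil(1), of f "-1" x 0 "[]"] slot_linear_hd[OF Nil(1), of f 1 0 0 "[]"] by (cases g) simp_all
  have Dact: "D [(f + g, act b x)] = signed (f * j) (act b (D [(g, x)])) + act (\<sigma> [] b) x"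
    if "b \<in> GA f" "x \<in> GL g" for b f g x
    using has_symbolD[OF Nil(4), of "[]" b f x g] that by simp
  have uy: "br ?u y \<in> GL (?k + d)" using u y L.br_even by blast
  \<comment> \<open>The Leibniz rule splits the argument into two multiples, by
    \<open>\<rho> ?u a\<close> and by \<open>a\<close>; the symbol rule for \<open>D\<close> then
    applies to each of them.\<close>
  have 1: "D [(?k + (e + d), br ?u (act a y))] = signed ((?k + e) * j) (act (\<rho> ?u a) (D [(d, y)]))
      + act (\<sigma> [] (\<rho> ?u a)) y + signed (?k * e) (signed (e * j) (act a (D [(?k + d, br ?u y)])) + act (\<sigma> [] a) (br ?u y))"
    using Dact[OF rho_degree[OF u a] y] Dact[OF a uy]
    by (simp add: br_act_right[OF u a] D0 Dsg ac_simps)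
  have Dy: "D [(d, y)] \<in> GL (j + d)"
    using slot_degreeD[OF Nil(2), of "[(d, y)]"] y by simp
  have sa: "\<sigma> [] a \<in> GA (j + e)"
    using graded_derD[OF Nil(3), of "[]"] a by (simp add: A.superderivation_iff)
  have 2: "br (D [(e + d, act a y)]) ?u = signed (e * j) (act a (br (D [(d, y)]) ?u)
       - signed ((e + (j + d)) * ?k) (act (\<rho> ?u a) (D [(d, y)])))
     + (act (\<sigma> [] a) (br y ?u) - signed ((j + e + d) * ?k) (act (\<rho> ?u (\<sigma> [] a)) y))"
    by (simp add: Dact[OF a y] L.br_add_left L.br_signed_left br_act_left[OF u a Dy] br_act_left[OF u sa y])
  have 3: "br ?u y = - signed (?k * d) (br y ?u)" by (rule L.skew[OF u y])
  have 4: "act (\<sigma> [] a) (br ?u y) = - signed (?k * d) (act (\<sigma> [] a) (br y ?u))"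
    unfolding 3 by (simp add: act_minus_right act_signed_right)
  have "L.lie_deriv D u [(e + d, act a y)] = D [(?k + (e + d), br ?u (act a y))] + signed (?k * (e + d)) (br (D [(e + d, act a y)]) ?u)"
    by (simp add: L.pair_bracket_def)
  moreover have "L.lie_deriv D u [(d, y)] = D [(?k + d, br ?u y)] + signed (?k * d) (br (D [(d, y)]) ?u)"
    by (simp add: L.pair_bracket_def)
  moreover obtain k where k: "?k = k" by blast
  ultimately show ?case unfolding 1 2 4 unfolding k
    by (cases k; cases e; cases d; cases j; simp add: act_add_right act_minus_right act_minus_left
      act_diff_left act_add_left act_diff_right k)
next
  case (Cons w zs)
  have IH: "L.lie_deriv (\<lambda>zs. D (w # zs)) u (zs @ [(e + d, act a y)]) =
       signed (e * (j + fst w + fst u + total_degree zs)) (act a (L.lie_deriv (\<lambda>zs. D (w # zs)) u (zs @ [(d, y)])))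
       + act (lie_deriv_symbol (j + fst w) (\<lambda>zs. \<sigma> (w # zs)) u zs a) y"
    by (rule Cons.IH) (use Cons.prems in \<open>auto intro: slot_linear_Cons slot_degree_Cons graded_der_Cons has_symbol_Cons\<close>)
  have "D ((L.pair_bracket u w # zs) @ [(e + d, act a y)]) =
     signed (e * (j + total_degree (L.pair_bracket u w # zs))) (act a (D ((L.pair_bracket u w # zs) @ [(d, y)]))) + act (\<sigma> (L.pair_bracket u w # zs) a) y"
    by (rule has_symbolD[OF Cons.prems(4) _ a y]) (use Cons.prems L.pair_bracket_hom in auto)
  then show ?case
    unfolding append_Cons L.lie_deriv.simps IH
    by (simp add: signed_add act_add_right act_add_left act_signed_left act_signed_right ac_simps)
qed

text \<open>With one argument, \<open>lie_diff D\<close> is the bracket with \<open>D []\<close> on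
  the left, whose symbol is \<open>\<rho> (D [])\<close>. In Cartan's formula the list behind
  \<open>w\<close> also contains the last entry \<open>act a y\<close>, which accounts for the
  exponent \<open>1 + parity zs\<close> in \<open>lie_diff_symbol\<close>.\<close>

lemma lie_diff_has_symbol_eq:
  assumes "slot_linear sL sL D" "slot_degree GL j D" "graded_der j \<sigma>" "has_symbol j D \<sigma>" "all_hom GL zs"
    and a: "a \<in> GA e" and y: "y \<in> GL d"
  shows "L.lie_diff D (zs @ [(e + d, act a y)]) =
       signed (e * (j + total_degree zs)) (act a (L.lie_diff D (zs @ [(d, y)]))) + act (lie_diff_symbol j D \<sigma> zs a) y"
  using assms(1-5)
proof (induction zs arbitrary: j D \<sigma>)
  case Nil
  have "D [] \<in> GL j" using slot_degreeD[OF Nil(2), of "[]"] by simp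
  then show ?case by (simp add: br_act_right[OF _ a] ac_simps)
next
  case (Cons w zs)
  have IH: "L.lie_diff (\<lambda>zs. D (w # zs)) (zs @ [(e + d, act a y)]) =
       signed (e * (j + fst w + total_degree zs)) (act a (L.lie_diff (\<lambda>zs. D (w # zs)) (zs @ [(d, y)])))
       + act (lie_diff_symbol (j + fst w) (\<lambda>zs. D (w # zs)) (\<lambda>zs. \<sigma> (w # zs)) zs a) y"
    by (rule Cons.IH) (use Cons.prems in \<open>auto intro: slot_linear_Cons slot_degree_Cons graded_der_Cons has_symbol_Cons\<close>)
  have "L.lie_deriv D w (zs @ [(e + d, act a y)]) =
       signed (e * (j + fst w + total_degree zs)) (act a (L.lie_deriv D w (zs @ [(d, y)]))) + act (lie_deriv_symbol j \<sigma> w zs a) y"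
    by (rule lie_deriv_has_symbol_eq) (use Cons.prems a y in auto)
  then show ?case
    unfolding append_Cons L.lie_diff.simps IH
    by (simp add: signed_add act_add_right act_add_left act_signed_left act_signed_right ac_simps)
qed

end

section \<open>Sums over unshuffles\<close>

text \<open>The first argument goes to the head of either block; going to the second one, it passes all of
  the first block, which has \<open>l + 1\<close> elements.\<close>

fun unshuffle_sum :: "nat \<Rightarrow> (bit \<times> 'l) list \<Rightarrow> ((bit \<times> 'l) list \<Rightarrow> (bit \<times> 'l) list \<Rightarrow> 'v) \<Rightarrow> 'v::ab_group_add" where
  "unshuffle_sum 0 zs F = F [] zs"
| "unshuffle_sum (Suc l) [] F = 0"
| "unshuffle_sum (Suc l) (u # zs) F = unshuffle_sum l zs (\<lambda>A. F (u # A)) +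
     unshuffle_sum (Suc l) zs (\<lambda>A B. signed (of_nat (Suc l) + fst u * total_degree A) (F A (u # B)))"

lemma unshuffle_sum_short: "length zs < l \<Longrightarrow> unshuffle_sum l zs F = 0"
  by (induction l zs F rule: unshuffle_sum.induct) auto

lemma psign_add: "psign (d + e) = (psign d * psign e :: 'k::field)"
  by (cases d; cases e) (auto simp: psign_def)

lemma psign_of_nat: "psign (of_nat n) = ((- 1) ^ n :: 'k::field)"
  by (induction n) (auto simp: psign_add, auto simp: psign_def)

lemma psign_sum: "finite S \<Longrightarrow> psign (sum f S) = (\<Prod>i\<in>S. psign (f i) :: 'k::field)"
  by (induction S rule: finite_induct) (auto simp: psign_add, auto simp: psign_def)

section \<open>Inserting the smallest value into a permutation\<close>

lemma insert_0_at: "permutation_insert p 0 \<tau> p = 0"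
  and insert_0_less: "i < p \<Longrightarrow> permutation_insert p 0 \<tau> i = Suc (\<tau> i)"
  and insert_0_ge: "p \<le> i \<Longrightarrow> permutation_insert p 0 \<tau> (Suc i) = Suc (\<tau> i)"
  by (auto simp: permutation_insert_expand)

lemma insert_0_index: "permutation_insert p 0 \<tau> (insert_index p i) = Suc (\<tau> i)"
  by (auto simp: permutation_insert_expand insert_index_def)

lemma insert_index_cases: "i = p \<or> (\<exists>k. i = insert_index p k)"
proof (cases i p rule: linorder_cases)
  case less
  then have "i = insert_index p i" by (simp add: insert_index_def)
  then show ?thesis by blast
next
  case greater
  then have "i = insert_index p (i - 1)" by (auto simp: insert_index_def)
  then show ?thesis by blast
qed simp

text \<open>The inserted value \<open>0\<close> is the smallest, so its inversions are exactly those
  with the \<open>l\<close> positions before it. They contribute \<open>(-1)^l\<close> to the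
  signature and the product of \<open>d\<close> with each of the first \<open>l\<close> permuted
  degrees to the Koszul exponent.\<close>

lemma eps_insert:
  assumes \<tau>: "\<tau> permutes {..<length ds}" and l: "l \<le> length ds"
  shows "eps (permutation_insert l 0 \<tau>) (d # ds)
    = (psign (of_nat l + d * (\<Sum>i<l. ds ! \<tau> i)) * eps \<tau> ds :: 'k::field)"
proof -
  let ?n = "length ds" and ?\<tau> = "permutation_insert l 0 \<tau>" and ?s = "insert_index l"
  let ?I = "{(i, j). i < j \<and> j < ?n \<and> \<tau> j < \<tau> i}"
  let ?J = "{(i, j). i < j \<and> j < length (d # ds) \<and> ?\<tau> j < ?\<tau> i}"
  have s_less: "?s i < ?s j \<longleftrightarrow> i < j" and s_bound: "?s i < Suc ?n \<longleftrightarrow> i < ?n"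
    and s_inj: "?s i = ?s j \<longleftrightarrow> i = j" for i j
    using l by (auto simp: insert_index_def)
  \<comment> \<open>The new inversions end in position \<open>l\<close>; the others are those of
    \<open>\<tau>\<close>, relabelled by skipping \<open>l\<close>.\<close>
  have J: "?J = (\<lambda>i. (i, l)) ` {..<l} \<union> (\<lambda>(i, j). (?s i, ?s j)) ` ?I" (is "_ = ?A \<union> ?B")
  proof (intro equalityI subsetI)
    fix x assume "x \<in> ?J"
    then obtain i j where x: "x = (i, j)" "i < j" "j < Suc ?n" "?\<tau> j < ?\<tau> i" by auto
    have "i \<noteq> l" using x insert_0_at[of l \<tau>] by auto
    then obtain i' where i': "i = ?s i'" using insert_index_cases by blast
    show "x \<in> ?A \<union> ?B"
    proof (cases "j = l")
      case True then show ?thesis using x by auto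
    next
      case False
      then obtain j' where j': "j = ?s j'" using insert_index_cases by blast
      have "(i', j') \<in> ?I" using x by (simp add: i' j' s_less s_bound insert_0_index)
      then show ?thesis using x i' j' by auto
    qed
  next
    fix x assume "x \<in> ?A \<union> ?B"
    then show "x \<in> ?J"
      using l by (auto simp: insert_0_at insert_0_less insert_0_index s_less s_bound)
  qed
  have "finite ?I" by (rule finite_subset[of _ "{..<?n} \<times> {..<?n}"]) auto
  have disj: "?A \<inter> ?B = {}" by (auto simp: insert_index_def split: if_splits)
  let ?w = "\<lambda>(i, j). psign ((d # ds) ! ?\<tau> i * (d # ds) ! ?\<tau> j) :: 'k"
  have "prod ?w ?J = prod ?w ?A * prod ?w ?B"
    unfolding J by (rule prod.union_disjoint) (use \<open>finite ?I\<close> disj in auto)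
  also have "prod ?w ?A = (\<Prod>i<l. psign (d * ds ! \<tau> i))"
    by (subst prod.reindex) (auto simp: inj_on_def insert_0_at insert_0_less ac_simps)
  also have "\<dots> = psign (d * (\<Sum>i<l. ds ! \<tau> i))"
    by (simp add: psign_sum sum_distrib_left)
  also have "prod ?w ?B = (\<Prod>(i, j)\<in>?I. psign (ds ! \<tau> i * ds ! \<tau> j))"
    by (subst prod.reindex) (auto simp: inj_on_def s_inj insert_0_index intro!: prod.cong)
  finally have *: "prod ?w ?J = psign (d * (\<Sum>i<l. ds ! \<tau> i)) * (\<Prod>(i, j)\<in>?I. psign (ds ! \<tau> i * ds ! \<tau> j))" .
  have "of_int (sign ?\<tau>) = ((- 1) ^ l * of_int (sign \<tau>) :: 'k)"
    using signof_permutation_insert[of \<tau> ?n l 0] \<tau> l by (simp add: lessThan_atLeast0)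
  then show ?thesis
    unfolding eps_def * by (simp add: psign_add psign_of_nat)
qed

lemma shuffles_of_0: "shuffles_of 0 n = {id}"
proof -
  have "\<tau> = id" if \<tau>: "\<tau> permutes {..<n}" "strict_mono_on {0..<n} \<tau>" for \<tau>
  proof (rule permutes_natset_ge[OF \<tau>(1)])
    have "i < n \<Longrightarrow> i \<le> \<tau> i" for i
    proof (induction i)
      case (Suc i)
      then have "\<tau> i < \<tau> (Suc i)" using \<tau>(2) by (auto simp: strict_mono_on_def)
      then show ?case using Suc by simp
    qed simp
    then show "\<forall>i\<in>{..<n}. i \<le> \<tau> i" by simp
  qed
  then show ?thesis
    by (auto simp: shuffles_of_def permutes_id strict_mono_on_def)
qed

lemma strict_mono_on_shift:
  assumes f: "\<And>i. f (Suc i) = Suc (g i)" and zero: "0 \<in> S \<Longrightarrow> f 0 = (0::nat)"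
    and S: "\<And>i. Suc i \<in> S \<longleftrightarrow> i \<in> T"
  shows "strict_mono_on S f \<longleftrightarrow> strict_mono_on T g"
proof
  assume A: "strict_mono_on S f"
  show "strict_mono_on T g"
  proof (rule strict_mono_onI)
    fix r s assume "r \<in> T" "s \<in> T" "r < s"
    then show "g r < g s" using strict_mono_onD[OF A, of "Suc r" "Suc s"] by (simp add: f S)
  qed
next
  assume A: "strict_mono_on T g"
  show "strict_mono_on S f"
  proof (rule strict_mono_onI)
    fix r s assume rs: "r \<in> S" "s \<in> S" "r < s"
    then obtain s' where s': "s = Suc s'" by (cases s) auto
    show "f r < f s"
    proof (cases r)
      case 0
      then show ?thesis using rs zero by (simp add: f s')
    next
      case (Suc r')
      then show ?thesis using rs strict_mono_onD[OF A, of r' s'] by (simp add: f S s')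
    qed
  qed
qed

lemma strict_mono_on_insert_0_first:
  "strict_mono_on {..<Suc l} (permutation_insert 0 0 \<tau>) \<longleftrightarrow> strict_mono_on {..<l} \<tau>"
  "strict_mono_on {Suc l..<Suc n} (permutation_insert 0 0 \<tau>) \<longleftrightarrow> strict_mono_on {l..<n} \<tau>"
  by (rule strict_mono_on_shift; simp add: insert_0_at insert_0_ge)+

lemma strict_mono_on_insert_0_second:
  "strict_mono_on {..<l} (permutation_insert l 0 \<tau>) \<longleftrightarrow> strict_mono_on {..<l} \<tau>"
  "strict_mono_on {l..<Suc n} (permutation_insert l 0 \<tau>) \<longleftrightarrow> strict_mono_on {l..<n} \<tau>"
proof -
  show "strict_mono_on {..<l} (permutation_insert l 0 \<tau>) \<longleftrightarrow> strict_mono_on {..<l} \<tau>"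
    by (simp add: strict_mono_on_def insert_0_less)
  have *: "permutation_insert l 0 \<tau> i = (if i = l then 0 else Suc (\<tau> (i - 1)))" if "l \<le> i" for i
    using that by (cases i) (auto simp add: insert_0_at insert_0_ge)
  show "strict_mono_on {l..<Suc n} (permutation_insert l 0 \<tau>) \<longleftrightarrow> strict_mono_on {l..<n} \<tau>"
  proof
    assume A: "strict_mono_on {l..<Suc n} (permutation_insert l 0 \<tau>)"
    show "strict_mono_on {l..<n} \<tau>"
    proof (rule strict_mono_onI)
      fix r s assume "r \<in> {l..<n}" "s \<in> {l..<n}" "r < s"
      then show "\<tau> r < \<tau> s"
        using strict_mono_onD[OF A, of "Suc r" "Suc s"] by (simp add: *)
    qed
  next
    assume A: "strict_mono_on {l..<n} \<tau>"
    show "strict_mono_on {l..<Suc n} (permutation_insert l 0 \<tau>)"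
    proof (rule strict_mono_onI)
      fix r s assume "r \<in> {l..<Suc n}" "s \<in> {l..<Suc n}" "r < s"
      then show "permutation_insert l 0 \<tau> r < permutation_insert l 0 \<tau> s"
        using strict_mono_onD[OF A, of "r - 1" "s - 1"] by (auto simp: *)
    qed
  qed
qed

text \<open>Both blocks are increasing, so the value \<open>0\<close> stands at the head of one of
  them, in position \<open>0\<close> or \<open>Suc l\<close>. For \<open>l = n\<close> the second
  block is empty and only the first case occurs.\<close>

lemma shuffles_of_Suc:
  assumes "l \<le> n"
  shows "shuffles_of (Suc l) (Suc n) = permutation_insert 0 0 ` shuffles_of l n \<union>
    (if l < n then permutation_insert (Suc l) 0 ` shuffles_of (Suc l) n else {})"
    (is "_ = ?A \<union> ?B")
proof (intro equalityI subsetI)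
  fix \<tau> assume \<tau>: "\<tau> \<in> shuffles_of (Suc l) (Suc n)"
  then have perm: "\<tau> permutes {0..<Suc n}" by (simp add: shuffles_of_def lessThan_atLeast0)
  obtain p where p: "\<tau> p = 0" using permutes_surj[OF perm] by (metis surjD)
  have "p < Suc n" using permutes_not_in[OF perm, of p] p by (cases "p < Suc n") auto
  then have "\<tau> \<in> permutation_insert p 0 ` {q. q permutes {0..<n}}"
    using permutation_fix[of p n 0] perm p by auto
  then obtain q where q: "q permutes {..<n}" "\<tau> = permutation_insert p 0 q"
    by (auto simp: lessThan_atLeast0)
  consider "p = 0" | "p = Suc l"
  proof -
    have "\<not> (0 < p \<and> p < Suc l)"
      using \<tau> p strict_mono_onD[of "{..<Suc l}" \<tau> 0 p] by (auto simp: shuffles_of_def)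
    moreover have "\<not> Suc l < p"
      using \<tau> p \<open>p < Suc n\<close> strict_mono_onD[of "{Suc l..<Suc n}" \<tau> "Suc l" p] by (auto simp: shuffles_of_def)
    ultimately show ?thesis using that by linarith
  qed
  then show "\<tau> \<in> ?A \<union> ?B"
  proof cases
    case 1
    then have "q \<in> shuffles_of l n"
      using \<tau> q by (simp add: shuffles_of_def strict_mono_on_insert_0_first)
    then show ?thesis using q 1 by blast
  next
    case 2
    then have "q \<in> shuffles_of (Suc l) n" "l < n"
      using \<tau> q \<open>p < Suc n\<close> by (simp_all add: shuffles_of_def strict_mono_on_insert_0_second)
    then show ?thesis using q 2 by auto
  qed
next
  fix \<tau> assume "\<tau> \<in> ?A \<union> ?B"
  then show "\<tau> \<in> shuffles_of (Suc l) (Suc n)"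
    using permutation_insert_permutes[of _ n 0 0] permutation_insert_permutes[of _ n "Suc l" 0]
    by (auto simp: shuffles_of_def strict_mono_on_insert_0_first strict_mono_on_insert_0_second
        lessThan_atLeast0[of n] lessThan_atLeast0[of "Suc n"] split: if_splits)
qed

lemma finite_shuffles_of: "finite (shuffles_of l n)"
  by (rule finite_subset[OF _ finite_permutations[of "{..<n}"]]) (auto simp: shuffles_of_def)

context vector_space
begin

text \<open>The two cases of \<open>shuffles_of_Suc\<close> are the two summands in the recursion of
  \<open>unshuffle_sum\<close>, and \<open>eps_insert\<close> at the positions \<open>0\<close> and
  \<open>Suc l\<close> supplies the sign of each.\<close>

lemma sum_shuffles_of:
  fixes F :: "(bit \<times> 'l) list \<Rightarrow> (bit \<times> 'l) list \<Rightarrow> 'b"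
  assumes "l \<le> length zs"
  shows "(\<Sum>\<tau>\<in>shuffles_of l (length zs). scale (eps \<tau> (map fst zs))
      (F (map (\<lambda>i. zs ! \<tau> i) [0..<l]) (map (\<lambda>i. zs ! \<tau> i) [l..<length zs]))) = unshuffle_sum l zs F"
  using assms
proof (induction l zs F rule: unshuffle_sum.induct)
  case (1 zs F)
  have empty: "{(i, j). i < j \<and> j < length ds \<and> j < i} = {}" for ds :: "bit list"
    by auto
  have "eps (\<lambda>i. i) ds = (1 :: 'a)" for ds
    unfolding eps_def empty by (simp add: sign_id[unfolded id_def])
  then show ?case by (simp add: shuffles_of_0 map_nth)
next
  case (2 l F)
  then show ?case by simp
next
  case (3 l u zs F)
  let ?n = "length zs" and ?zs = "u # zs"
  let ?t = "\<lambda>\<tau>. scale (eps \<tau> (map fst ?zs))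
      (F (map (\<lambda>i. ?zs ! \<tau> i) [0..<Suc l]) (map (\<lambda>i. ?zs ! \<tau> i) [Suc l..<Suc ?n]))"
  have l: "l \<le> ?n" using 3 by simp
  have perm: "\<tau> permutes {..<?n}" if "\<tau> \<in> shuffles_of k ?n" for \<tau> k
    using that by (simp add: shuffles_of_def)
  have inj: "inj_on (permutation_insert p 0) (shuffles_of k ?n)" if "p < Suc ?n" for k p
    by (rule inj_on_subset[OF permutation_insert_inj_on[OF that, of 0]])
      (auto simp: shuffles_of_def lessThan_atLeast0)
  have upt1: "[0..<Suc l] = 0 # map Suc [0..<l]" and upt2: "[Suc l..<Suc ?n] = map Suc [l..<?n]"
    by (simp_all add: upt_conv_Cons map_Suc_upt del: upt_Suc)
  have "sum ?t (permutation_insert 0 0 ` shuffles_of l ?n)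
      = (\<Sum>\<tau>\<in>shuffles_of l ?n. ?t (permutation_insert 0 0 \<tau>))"
    by (subst sum.reindex[OF inj]) simp_all
  also have "\<dots> = unshuffle_sum l zs (\<lambda>A. F (u # A))"
  proof (subst "3.IH"(1)[OF l, symmetric], rule sum.cong[OF refl])
    fix \<tau> assume \<tau>: "\<tau> \<in> shuffles_of l ?n"
    have "eps (permutation_insert 0 0 \<tau>) (map fst ?zs) = (eps \<tau> (map fst zs) :: 'a)"
      using eps_insert[of \<tau> "map fst zs" 0 "fst u"] perm[OF \<tau>] by (simp add: psign_def)
    then show "?t (permutation_insert 0 0 \<tau>) = scale (eps \<tau> (map fst zs))
        (F (u # map (\<lambda>i. zs ! \<tau> i) [0..<l]) (map (\<lambda>i. zs ! \<tau> i) [l..<?n]))"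
      unfolding upt1 upt2 by (simp add: insert_0_at insert_0_ge comp_def del: upt_Suc)
  qed
  finally have A: "sum ?t (permutation_insert 0 0 ` shuffles_of l ?n) = unshuffle_sum l zs (\<lambda>A. F (u # A))" .
  let ?B = "if l < ?n then permutation_insert (Suc l) 0 ` shuffles_of (Suc l) ?n else {}"
  let ?G = "\<lambda>A B. signed (of_nat (Suc l) + fst u * total_degree A) (F A (u # B))"
  have B: "sum ?t ?B = unshuffle_sum (Suc l) zs ?G"
  \<comment> \<open>Otherwise no unshuffle has the first argument in its second block, and the right
    side is a sum over a list that is too short.\<close>
  proof (cases "l < ?n")
    case True
    then have l': "Suc l \<le> ?n" by simp
    have "sum ?t (permutation_insert (Suc l) 0 ` shuffles_of (Suc l) ?n)
        = (\<Sum>\<tau>\<in>shuffles_of (Suc l) ?n. ?t (permutation_insert (Suc l) 0 \<tau>))"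
      by (subst sum.reindex[OF inj]) (use True in simp_all)
    also have "\<dots> = unshuffle_sum (Suc l) zs ?G"
    proof (subst "3.IH"(2)[OF l', symmetric], rule sum.cong[OF refl])
      fix \<tau> assume \<tau>: "\<tau> \<in> shuffles_of (Suc l) ?n"
      let ?xs = "map (\<lambda>i. zs ! \<tau> i) [0..<Suc l]" and ?ys = "map (\<lambda>i. zs ! \<tau> i) [Suc l..<?n]"
      have less: "\<tau> i < ?n" if "i < ?n" for i
        using permutes_in_image[OF perm[OF \<tau>], of i] that by simp
      have "total_degree ?xs = (\<Sum>i<Suc l. fst (zs ! \<tau> i))"
        by (simp add: total_degree_def comp_def sum_list_distinct_conv_sum_set lessThan_atLeast0 del: upt_Suc)
      also have "\<dots> = (\<Sum>i<Suc l. map fst zs ! \<tau> i)"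
        by (rule sum.cong) (use l' less in auto)
      finally have deg: "total_degree ?xs = (\<Sum>i<Suc l. map fst zs ! \<tau> i)" .
      have eps: "eps (permutation_insert (Suc l) 0 \<tau>) (map fst ?zs)
          = (psign (of_nat (Suc l) + fst u * total_degree ?xs) * eps \<tau> (map fst zs) :: 'a)"
        using eps_insert[of \<tau> "map fst zs" "Suc l" "fst u"] perm[OF \<tau>] l' unfolding deg by simp
      have 1: "map (\<lambda>i. ?zs ! permutation_insert (Suc l) 0 \<tau> i) [0..<Suc l] = ?xs"
        by (rule map_cong[OF refl]) (auto simp: insert_0_less)
      have "[Suc l..<Suc ?n] = Suc l # map Suc [Suc l..<?n]"
        using True by (simp add: upt_conv_Cons map_Suc_upt del: upt_Suc)
      then have 2: "map (\<lambda>i. ?zs ! permutation_insert (Suc l) 0 \<tau> i) [Suc l..<Suc ?n] = u # ?ys"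
        by (simp add: insert_0_at insert_0_ge del: upt_Suc)
      show "?t (permutation_insert (Suc l) 0 \<tau>) = scale (eps \<tau> (map fst zs)) (?G ?xs ?ys)"
        unfolding 1 2 eps by (simp add: scale_psign scale_signed flip: scale_scale del: upt_Suc of_nat_Suc)
    qed
    finally show ?thesis using True by simp
  qed (simp add: unshuffle_sum_short)
  have "(\<Sum>\<tau>\<in>shuffles_of (Suc l) (length ?zs). ?t \<tau>)
      = sum ?t (permutation_insert 0 0 ` shuffles_of l ?n) + sum ?t ?B"
    unfolding length_Cons shuffles_of_Suc[OF l]
  proof (rule sum.union_disjoint)
    have "permutation_insert 0 0 \<tau> \<noteq> permutation_insert (Suc l) 0 \<tau>'" for \<tau> \<tau>'
      by (metis insert_0_at insert_0_less nat.distinct(1) zero_less_Suc)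
    then show "permutation_insert 0 0 ` shuffles_of l ?n \<inter> ?B = {}" by auto
  qed (simp_all add: finite_shuffles_of)
  then show ?case unfolding A B by (simp only: unshuffle_sum.simps length_Cons)
qed

end

section \<open>The operator on homogeneous arguments\<close>

lemma unshuffle_sum_signed: "unshuffle_sum l zs (\<lambda>A B. signed d (F A B)) = signed d (unshuffle_sum l zs F)"
proof (induction l zs F rule: unshuffle_sum.induct)
  case (3 l u zs F)
  have "unshuffle_sum (Suc l) zs (\<lambda>A B. signed (of_nat (Suc l) + fst u * total_degree A) (signed d (F A (u # B))))
      = signed d (unshuffle_sum (Suc l) zs (\<lambda>A B. signed (of_nat (Suc l) + fst u * total_degree A) (F A (u # B))))"
    using 3(2) by (simp only: signed_signed add.commute[of d])
  then show ?case unfolding unshuffle_sum.simps 3(1) by (simp only: signed_add)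
qed simp_all

lemma unshuffle_sum_cong:
  assumes "\<And>A B. all_hom G A \<Longrightarrow> all_hom G B \<Longrightarrow> length A = l \<Longrightarrow> length A + length B = length zs \<Longrightarrow> F A B = F' A B"
    and "all_hom G zs"
  shows "unshuffle_sum l zs F = unshuffle_sum l zs F'"
  using assms
proof (induction l zs F arbitrary: F' rule: unshuffle_sum.induct)
  case (1 zs F)
  then show ?case by simp
next
  case (2 l F)
  then show ?case by simp
next
  case (3 l u zs F)
  have "unshuffle_sum l zs (\<lambda>A. F (u # A)) = unshuffle_sum l zs (\<lambda>A. F' (u # A))"
    by (rule 3(1)) (use 3(3,4) in auto)
  moreover have "unshuffle_sum (Suc l) zs (\<lambda>A B. signed (of_nat (Suc l) + fst u * total_degree A) (F A (u # B)))
      = unshuffle_sum (Suc l) zs (\<lambda>A B. signed (of_nat (Suc l) + fst u * total_degree A) (F' A (u # B)))"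
  proof (rule 3(2))
    fix A B :: "(bit \<times> 'a) list"
    assume "all_hom G A" "all_hom G B" "length A = Suc l" "length A + length B = length zs"
    then have "F A (u # B) = F' A (u # B)" using 3(3)[of A "u # B"] 3(4) by simp
    then show "signed (of_nat (Suc l) + fst u * total_degree A) (F A (u # B)) = signed (of_nat (Suc l) + fst u * total_degree A) (F' A (u # B))"
      by simp
  qed (use 3(4) in simp)
  ultimately show ?case by (simp only: unshuffle_sum.simps)
qed

lemma unshuffle_sum_full: "unshuffle_sum (length zs) zs F = F zs []"
  by (induction zs arbitrary: F) (simp_all add: unshuffle_sum_short)

lemma finite_bit_lists: "finite {ds :: bit list. length ds = n}"
proof -
  have "(UNIV :: bit set) = {0, 1}" by (auto intro: bit.exhaust)
  then have "finite (UNIV :: bit set)" by (metis finite.emptyI finite.insertI)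
  from finite_lists_length_eq[OF this, of n] show ?thesis by simp
qed

lemma linearI_combination:
  assumes "vector_space s" "vector_space t" and f: "\<And>c x y. f (s c x + y) = t c (f x) + f y"
  shows "Vector_Spaces.linear s t f"
proof -
  interpret s: vector_space s by fact
  interpret t: vector_space t by fact
  have zero: "f 0 = 0" using f[of 1 0 0] by simp
  show ?thesis
  proof unfold_locales
    show "f (x + y) = f x + f y" for x y using f[of 1 x y] by simp
    show "f (s c x) = t c (f x)" for c x using f[of c x 0] zero by simp
  qed
qed

lemma slot_linear_zero:
  assumes "vector_space t" "vector_space s" "slot_linear s t D"
  shows "D (zs @ (d, 0) # zs') = 0"
proof -
  interpret s: vector_space s by fact
  interpret t: vector_space t by fact
  show ?thesis using slot_linearD[OF assms(3), of zs d 1 0 0 zs'] by simp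
qed

lemma multilinear_slot_linear:
  assumes "multilinear s t n f" "\<And>xs. length xs \<noteq> n \<Longrightarrow> f xs = 0" "vector_space t"
  shows "slot_linear s t (\<lambda>zs. f (map snd zs))"
  unfolding slot_linear_def
proof (intro allI)
  interpret t: vector_space t by fact
  fix zs d c x y zs'
  let ?f = "\<lambda>x. f (map snd (zs @ (d, x) # zs'))"
  show "?f (s c x + y) = t c (?f x) + ?f y"
  proof (cases "length (zs @ (d, x) # zs') = n")
    case True
    let ?xs = "map snd zs @ x # map snd zs'"
    have "Vector_Spaces.linear s t (\<lambda>z. f (?xs[length zs := z]))"
      using assms(1) True unfolding multilinear_def by simp
    moreover have "f (?xs[length zs := z]) = ?f z" for z
      using list_update_length[of "map snd zs" x "map snd zs'" z] by simp
    ultimately interpret l: Vector_Spaces.linear s t ?f by simp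
    show ?thesis by (simp only: l.add l.scale)
  next
    case False
    then show ?thesis using assms(2) by simp
  qed
qed

lemma all_hom_zip: "length ds = length xs \<Longrightarrow> all_hom G (zip ds xs) \<longleftrightarrow> homogeneous G ds xs"
  by (induction ds xs rule: list_induct2) (auto simp: homogeneous_def)

lemma homogeneous_length: "homogeneous G ds xs \<Longrightarrow> length ds = length xs"
  by (auto simp: homogeneous_def dest: list_all2_lengthD)

lemma homogeneous_map: "homogeneous G (map fst zs) (map snd zs) \<longleftrightarrow> all_hom G zs"
  by (induction zs) (auto simp: homogeneous_def)

lemma total_degree_zip: "length ds = length xs \<Longrightarrow> total_degree (zip ds xs) = sum_list ds"
  by (simp add: total_degree_def)

section \<open>Extension from homogeneous to arbitrary arguments\<close>

context superspace
begin

definition components :: "bit list \<Rightarrow> 'v list \<Rightarrow> (bit \<times> 'v) list" where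
  "components ds xs = zip ds (map2 (component G) ds xs)"

lemma components_simps [simp]: "components [] [] = []" "components (d # ds) (x # xs) = (d, component G d x) # components ds xs"
  by (simp_all add: components_def)

lemma length_components [simp]: "length ds = length xs \<Longrightarrow> length (components ds xs) = length xs"
  by (simp add: components_def)

lemma nth_components: "length ds = length xs \<Longrightarrow> i < length xs \<Longrightarrow> components ds xs ! i = (ds ! i, component G (ds ! i) (xs ! i))"
  by (simp add: components_def)

lemma fst_components: "length ds = length xs \<Longrightarrow> map fst (components ds xs) = ds"
  by (simp add: components_def)

lemma all_hom_components: "length ds = length xs \<Longrightarrow> all_hom G (components ds xs)"
  by (induction ds xs rule: list_induct2) (auto intro: component_spec)

lemma components_hom: "all_hom G zs \<Longrightarrow> components (map fst zs) (map snd zs) = zs"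
  by (induction zs) (auto simp: component_same)

lemma components_append: "length ds = length xs \<Longrightarrow> components (ds @ ds') (xs @ xs') = components ds xs @ components ds' xs'"
  by (induction ds xs rule: list_induct2) auto

lemma components_other:
  assumes "all_hom G zs" "length ds = length zs" "ds \<noteq> map fst zs"
  shows "\<exists>A d B. components ds (map snd zs) = A @ (d, 0) # B"
  using assms(2,1,3)
proof (induction ds zs rule: list_induct2)
  case (Cons d ds z zs)
  show ?case
  proof (cases "d = fst z")
    case True
    then obtain A e B where "components ds (map snd zs) = A @ (e, 0) # B" using Cons by auto
    then have "components (d # ds) (map snd (z # zs)) = ((d, component G d (snd z)) # A) @ (e, 0) # B" by simp
    then show ?thesis by blast
  next
    case False
    then have "components (d # ds) (map snd (z # zs)) = [] @ (d, 0) # components ds (map snd zs)"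
      using component_other[of "snd z" "fst z" d] Cons(3) by simp
    then show ?thesis by blast
  qed
qed simp

text \<open>This is the sum over choices of degrees that \<open>circ\<close> uses, so both
  compositions in \<open>delta\<close> have this form before anything about \<open>f\<close> is
  known.\<close>

definition multi_ext :: "nat \<Rightarrow> ((bit \<times> 'v) list \<Rightarrow> 'w::ab_group_add) \<Rightarrow> 'v list \<Rightarrow> 'w" where
  "multi_ext n D xs = (if length xs = n then \<Sum>ds\<in>{ds. length ds = n}. D (components ds xs) else 0)"

text \<open>A homogeneous element has component zero in the other degree. Every choice of degrees
  except the actual one thus puts a zero into some slot, and by linearity its summand
  vanishes.\<close>

lemma multi_ext_hom:
  assumes "vector_space t" "slot_linear scale t D" "all_hom G zs" "length zs = n"
  shows "multi_ext n D (map snd zs) = D zs"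
proof -
  have "(\<Sum>ds\<in>{ds. length ds = n}. D (components ds (map snd zs))) = (\<Sum>ds\<in>{map fst zs}. D (components ds (map snd zs)))"
  proof (rule sum.mono_neutral_right[OF finite_bit_lists])
    show "\<forall>ds\<in>{ds. length ds = n} - {map fst zs}. D (components ds (map snd zs)) = 0"
    proof
      fix ds assume "ds \<in> {ds. length ds = n} - {map fst zs}"
      then obtain A d B where "components ds (map snd zs) = A @ (d, 0) # B"
        using components_other[OF assms(3), of ds] assms(4) by auto
      then show "D (components ds (map snd zs)) = 0"
        using slot_linear_zero[OF assms(1) vector_space_axioms assms(2)] by simp
    qed
  qed (use assms(4) in auto)
  then show ?thesis using assms by (simp add: multi_ext_def components_hom)
qed

lemma multi_ext_multilinear:
  assumes t: "vector_space t" and D: "slot_linear scale t D"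
  shows "multilinear scale t n (multi_ext n D)"
  unfolding multilinear_def
proof (intro allI impI)
  interpret t: vector_space t by fact
  fix xs :: "'v list" and i assume i: "length xs = n \<and> i < n"
  let ?l = "\<lambda>ds. take i ds" and ?r = "\<lambda>ds. drop (Suc i) ds"
  have components: "components ds (xs[i := x]) = components (take i ds) (take i xs) @ (ds ! i, component G (ds ! i) x)
      # components (drop (Suc i) ds) (drop (Suc i) xs)" if "length ds = n" for ds x
  proof -
    have "components (take i ds @ ds ! i # drop (Suc i) ds) (take i xs @ x # drop (Suc i) xs)
      = components (take i ds) (take i xs) @ (ds ! i, component G (ds ! i) x)
      # components (drop (Suc i) ds) (drop (Suc i) xs)"
      using i that by (subst components_append) auto
    then show ?thesis using i that by (simp add: upd_conv_take_nth_drop flip: id_take_nth_drop)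
  qed
  show "Vector_Spaces.linear scale t (\<lambda>x. multi_ext n D (xs[i := x]))"
    by (rule linearI_combination[OF vector_space_axioms t])
      (use i in \<open>simp add: multi_ext_def components component_linear slot_linearD[OF D] sum.distrib t.scale_sum_right\<close>)
qed

end

section \<open>Comparison of the recursion with the unshuffle formula\<close>

context lie_superalgebra
begin

text \<open>The recursion brackets \<open>u\<close> with an argument in place; skew-symmetry carries
  the bracket to the head, which turns the choice of that argument into an unshuffle with a first
  block of one element.\<close>

lemma lie_deriv_unshuffle_sum:
  assumes "slot_skew GL D" "all_hom GL (u # zs)"
  shows "lie_deriv D u zs = signed (fst u * total_degree zs) (br (D zs) (snd u)) + unshuffle_sum 1 zs (\<lambda>A B. D (pair_bracket u (hd A) # B))"
  using assms
proof (induction zs arbitrary: D)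
  case (Cons v zs)
  have IH: "lie_deriv (\<lambda>zs. D (v # zs)) u zs = signed (fst u * total_degree zs) (br (D (v # zs)) (snd u))
      + unshuffle_sum 1 zs (\<lambda>A B. D (v # pair_bracket u (hd A) # B))"
    by (rule Cons.IH) (use Cons.prems in \<open>auto intro: slot_skew_Cons\<close>)
  have "unshuffle_sum 1 zs (\<lambda>A B. signed (of_nat 1 + fst v * total_degree A) (D (pair_bracket u (hd A) # v # B)))
      = unshuffle_sum 1 zs (\<lambda>A B. signed (fst u * fst v) (D (v # pair_bracket u (hd A) # B)))"
  proof (rule unshuffle_sum_cong)
    fix A B assume AB: "all_hom GL A" "all_hom GL B" "length A = 1"
    then obtain a where a: "A = [a]" by (cases A) auto
    have "D (pair_bracket u a # v # B) = - signed (fst (pair_bracket u a) * fst v) (D (v # pair_bracket u a # B))"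
      by (rule slot_skew_hd[OF Cons.prems(1)]) (use AB a Cons.prems pair_bracket_hom in auto)
    \<comment> \<open>Moving the bracket of \<open>u\<close> and \<open>a\<close> past
      \<open>v\<close>, against moving \<open>a\<close> alone past \<open>v\<close>, leaves the
      passage of \<open>u\<close> past \<open>v\<close>.\<close>
    moreover have "1 + fst v * fst a + (1 + (fst u + fst a) * fst v) = fst u * fst v"
      by (simp add: distrib_left distrib_right ac_simps)
    ultimately show "signed (of_nat 1 + fst v * total_degree A) (D (pair_bracket u (hd A) # v # B))
        = signed (fst u * fst v) (D (v # pair_bracket u (hd A) # B))"
      by (simp add: a flip: signed_Suc)
  qed (use Cons.prems in auto)
  then show ?case
    using unshuffle_sum_signed[of 1 zs "fst u * fst v" "\<lambda>A B. D (v # pair_bracket u (hd A) # B)"]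
    by (simp add: IH signed_add distrib_left ac_simps)
qed simp

text \<open>Splitting by the block that contains the head \<open>u\<close> sorts the terms as
  Cartan's formula does. With \<open>u\<close> in the first block of the first sum or the second
  block of the second sum, they form the differential with \<open>u\<close> inserted; the remaining
  ones form the Lie derivative along \<open>u\<close>.\<close>

lemma lie_diff_unshuffle_sum:
  assumes "slot_skew GL D" "all_hom GL zs" "length zs = Suc n"
  shows "lie_diff D zs = unshuffle_sum n zs (\<lambda>A B. br (D A) (snd (hd B)))
    + signed (of_nat n) (unshuffle_sum 2 zs (\<lambda>A B. D (pair_bracket (hd A) (hd (tl A)) # B)))"
  using assms
proof (induction n arbitrary: D zs)
  case 0
  then obtain u where "zs = [u]" by (cases zs) auto
  then show ?case by (simp add: numeral_2_eq_2)
next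
  case (Suc n)
  then obtain u zs' where zs: "zs = u # zs'" "length zs' = Suc n" by (cases zs) auto
  let ?D = "\<lambda>zs. D (u # zs)"
  have IH: "lie_diff ?D zs' = unshuffle_sum n zs' (\<lambda>A B. br (?D A) (snd (hd B)))
    + signed (of_nat n) (unshuffle_sum 2 zs' (\<lambda>A B. ?D (pair_bracket (hd A) (hd (tl A)) # B)))"
    by (rule Suc.IH) (use Suc.prems zs in \<open>auto intro: slot_skew_Cons\<close>)
  have R: "lie_deriv D u zs' = signed (fst u * total_degree zs') (br (D zs') (snd u)) + unshuffle_sum 1 zs' (\<lambda>A B. D (pair_bracket u (hd A) # B))"
    by (rule lie_deriv_unshuffle_sum) (use Suc.prems zs in auto)
  \<comment> \<open>Moving \<open>u\<close> past two arguments costs no parity sign, but moving it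
    past their bracket, a single argument, costs one; the Koszul signs agree and cancel.\<close>
  have "unshuffle_sum 2 zs' (\<lambda>A B. signed (of_nat 2 + fst u * total_degree A) (D (pair_bracket (hd A) (hd (tl A)) # u # B)))
      = unshuffle_sum 2 zs' (\<lambda>A B. signed 1 (?D (pair_bracket (hd A) (hd (tl A)) # B)))"
  proof (rule unshuffle_sum_cong)
    fix A B assume AB: "all_hom GL A" "all_hom GL B" "length A = 2"
    then obtain a b where ab: "A = [a, b]" by (auto simp: numeral_2_eq_2 length_Suc_conv)
    have "D (pair_bracket a b # u # B) = - signed (fst (pair_bracket a b) * fst u) (D (u # pair_bracket a b # B))"
      by (rule slot_skew_hd[OF Suc.prems(1)]) (use AB ab Suc.prems zs pair_bracket_hom in auto)
    then show "signed (of_nat 2 + fst u * total_degree A) (D (pair_bracket (hd A) (hd (tl A)) # u # B))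
        = signed 1 (D (u # pair_bracket (hd A) (hd (tl A)) # B))"
      by (simp add: ab signed_minus mult.commute)
  qed (use Suc.prems zs in auto)
  then have 2: "unshuffle_sum 2 zs (\<lambda>A B. D (pair_bracket (hd A) (hd (tl A)) # B)) = unshuffle_sum 1 zs' (\<lambda>A B. D (pair_bracket u (hd A) # B))
      - unshuffle_sum 2 zs' (\<lambda>A B. ?D (pair_bracket (hd A) (hd (tl A)) # B))"
    using unshuffle_sum_signed[of 2 zs' 1] by (simp add: zs numeral_2_eq_2)
  \<comment> \<open>If \<open>u\<close> is the single element of the second block, the first block
    must be all of \<open>zs'\<close>.\<close>
  have "unshuffle_sum (Suc n) zs' (\<lambda>A B. signed (of_nat (Suc n) + fst u * total_degree A) (br (D A) (snd u)))
      = signed (of_nat (Suc n) + fst u * total_degree zs') (br (D zs') (snd u))"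
    using unshuffle_sum_full[of zs'] zs by simp
  then have 1: "unshuffle_sum (Suc n) zs (\<lambda>A B. br (D A) (snd (hd B))) = unshuffle_sum n zs' (\<lambda>A B. br (?D A) (snd (hd B)))
      + signed (of_nat (Suc n) + fst u * total_degree zs') (br (D zs') (snd u))"
    by (simp add: zs)
  show ?case unfolding 1 2 unfolding zs(1) lie_diff.simps IH R zs(2)
    by (simp add: signed_add signed_diff signed_Suc add.assoc)
qed

lemma circ_unshuffle_sum:
  assumes "length xs = nat (p + q + 1)" "0 \<le> p" "nat (q + 1) \<le> nat (p + q + 1)"
  shows "circ sL GL p q f g xs
    = multi_ext (nat (p + q + 1)) (\<lambda>zs. unshuffle_sum (nat (q + 1)) zs (\<lambda>A B. f (g (map snd A) # map snd B))) xs"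
proof -
  let ?n = "nat (p + q + 1)" and ?l = "nat (q + 1)"
  let ?x = "\<lambda>ds i. component GL (ds ! i) (xs ! i)"
  have "(\<Sum>\<tau>\<in>shuffles_of ?l ?n. sL (eps \<tau> ds)
        (f (g (map (\<lambda>i. ?x ds (\<tau> i)) [0..<?l]) # map (\<lambda>i. ?x ds (\<tau> i)) [?l..<?n])))
      = unshuffle_sum ?l (components ds xs) (\<lambda>A B. f (g (map snd A) # map snd B))" if ds: "length ds = ?n" for ds
  proof (subst sum_shuffles_of[symmetric])
    show "?l \<le> length (components ds xs)" using assms ds by simp
    have "map (\<lambda>i. ?x ds (\<tau> i)) [a..<b] = map snd (map (\<lambda>i. components ds xs ! \<tau> i) [a..<b])"
      if "\<tau> \<in> shuffles_of ?l ?n" "b \<le> ?n" for \<tau> a b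
    proof -
      have "\<tau> i < ?n" if "i < ?n" for i
        using permutes_in_image[of \<tau> "{..<?n}" i] \<open>\<tau> \<in> _\<close> that by (simp add: shuffles_of_def)
      then show ?thesis using that(2) ds assms(1) by (auto simp: nth_components)
    qed
    note * = this
    show "(\<Sum>\<tau>\<in>shuffles_of ?l ?n. sL (eps \<tau> ds)
        (f (g (map (\<lambda>i. ?x ds (\<tau> i)) [0..<?l]) # map (\<lambda>i. ?x ds (\<tau> i)) [?l..<?n])))
      = (\<Sum>\<tau>\<in>shuffles_of ?l (length (components ds xs)). sL (eps \<tau> (map fst (components ds xs)))
        (f (g (map snd (map (\<lambda>i. components ds xs ! \<tau> i) [0..<?l]))
          # map snd (map (\<lambda>i. components ds xs ! \<tau> i) [?l..<length (components ds xs)]))))"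
    proof (rule sum.cong)
      show "shuffles_of ?l ?n = shuffles_of ?l (length (components ds xs))" using ds assms(1) by simp
      fix \<tau> assume "\<tau> \<in> shuffles_of ?l (length (components ds xs))"
      then have \<tau>: "\<tau> \<in> shuffles_of ?l ?n" using ds assms(1) by simp
      show "sL (eps \<tau> ds) (f (g (map (\<lambda>i. ?x ds (\<tau> i)) [0..<?l]) # map (\<lambda>i. ?x ds (\<tau> i)) [?l..<?n]))
        = sL (eps \<tau> (map fst (components ds xs))) (f (g (map snd (map (\<lambda>i. components ds xs ! \<tau> i) [0..<?l]))
          # map snd (map (\<lambda>i. components ds xs ! \<tau> i) [?l..<length (components ds xs)])))"
        unfolding *[OF \<tau> assms(3)] *[OF \<tau> order_refl] using ds assms(1) by (simp add: fst_components)
    qed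
  qed
  then show ?thesis
    unfolding circ_def multi_ext_def Let_def using assms by simp
qed

lemma nat_int_add [simp]: "nat (int n + 1) = Suc n" "nat (2 + int n) = Suc (Suc n)"
  by linarith+

lemma delta_off: "length xs \<noteq> Suc n \<Longrightarrow> delta sL GL br n f xs = 0"
  by (auto simp: delta_def Der_bracket_def circ_def nat_eq_iff)

text \<open>The only place where the unshuffles in \<open>delta\<close> are opened. Skew-symmetry of
  \<open>f\<close> enters through \<open>lie_diff_unshuffle_sum\<close>.\<close>

lemma delta_lie_diff:
  assumes alt: "slot_skew GL (\<lambda>zs. f (map snd zs))"
  shows "delta sL GL br n f = multi_ext (Suc n) (lie_diff (\<lambda>zs. f (map snd zs)))"
proof
  fix xs
  show "delta sL GL br n f xs = multi_ext (Suc n) (lie_diff (\<lambda>zs. f (map snd zs))) xs"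
  proof (cases "length xs = Suc n")
    case False
    then show ?thesis by (simp add: delta_off multi_ext_def)
  next
    case True
    let ?D = "\<lambda>zs. f (map snd zs)" and ?m = "bracket_map br"
    let ?M = "\<lambda>zs. unshuffle_sum n zs (\<lambda>A B. br (?D A) (snd (hd B)))"
    let ?N = "\<lambda>zs. unshuffle_sum 2 zs (\<lambda>A B. ?D (pair_bracket (hd A) (hd (tl A)) # B))"
    have "circ sL GL 1 (int n - 1) ?m f xs
        = multi_ext (Suc n) (\<lambda>zs. unshuffle_sum n zs (\<lambda>A B. ?m (f (map snd A) # map snd B))) xs"
      using circ_unshuffle_sum[of xs 1 "int n - 1" ?m f] True by simp
    also have "\<dots> = multi_ext (Suc n) ?M xs"
      unfolding multi_ext_def
    proof (intro if_cong refl sum.cong unshuffle_sum_cong[where G = GL])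
      fix ds and A B :: "(bit \<times> 'l) list"
      assume "ds \<in> {ds. length ds = Suc n}" "length A = n" "length A + length B = length (components ds xs)"
      then obtain b where "B = [b]" using True by (auto simp: length_Suc_conv)
      then show "?m (f (map snd A) # map snd B) = br (?D A) (snd (hd B))" by (simp add: bracket_map_def)
    qed (use True all_hom_components in auto)
    finally have 1: "circ sL GL 1 (int n - 1) ?m f xs = multi_ext (Suc n) ?M xs" .
    \<comment> \<open>The bracket prescribes the sign \<open>- (-1)^(n-1)\<close>, which is the
      \<open>(-1)^n\<close> of \<open>lie_diff_unshuffle_sum\<close>.\<close>
    have 2: "- sL ((- 1) powi (1 * (int n - 1))) (circ sL GL (int n - 1) 1 f ?m xs) = signed (of_nat n) (multi_ext (Suc n) ?N xs)"
    proof (cases n)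
      \<comment> \<open>Here \<open>f\<close> is an element of \<open>L\<close>: the composition is
        zero by convention, and one argument contains no pair to sum over.\<close>
      case 0
      then have "multi_ext (Suc n) ?N xs = 0"
        using True by (auto simp: multi_ext_def intro!: sum.neutral unshuffle_sum_short)
      then show ?thesis using 0 by (simp add: circ_def)
    next
      case (Suc k)
      have "circ sL GL (int n - 1) 1 f ?m xs = multi_ext (Suc n) (\<lambda>zs. unshuffle_sum 2 zs (\<lambda>A B. f (?m (map snd A) # map snd B))) xs"
        using circ_unshuffle_sum[of xs "int n - 1" 1 f ?m] True Suc by simp
      also have "\<dots> = multi_ext (Suc n) ?N xs"
        unfolding multi_ext_def
      proof (intro if_cong refl sum.cong unshuffle_sum_cong[where G = GL])
        fix ds and A B :: "(bit \<times> 'l) list" assume "length A = 2"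
        then obtain a b where "A = [a, b]" by (auto simp: numeral_2_eq_2 length_Suc_conv)
        then show "f (?m (map snd A) # map snd B) = ?D (pair_bracket (hd A) (hd (tl A)) # B)"
          by (simp add: bracket_map_def pair_bracket_def)
      qed (use True all_hom_components in auto)
      finally have "circ sL GL (int n - 1) 1 f ?m xs = multi_ext (Suc n) ?N xs" .
      moreover have "(- 1) powi (1 * (int n - 1)) = (psign (of_nat k) :: 'k)"
        by (simp add: Suc psign_of_nat)
      ultimately show ?thesis by (simp only: scale_psign Suc of_nat_Suc signed_Suc)
    qed
    have "delta sL GL br n f xs = multi_ext (Suc n) ?M xs + signed (of_nat n) (multi_ext (Suc n) ?N xs)"
      unfolding delta_def Der_bracket_def 1 by (subst 2[symmetric]) simp
    also have "\<dots> = (\<Sum>ds\<in>{ds. length ds = Suc n}. ?M (components ds xs) + signed (of_nat n) (?N (components ds xs)))"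
    proof -
      have "signed d (sum h S) = (\<Sum>x\<in>S. signed d (h x))" for d and h :: "bit list \<Rightarrow> 'l" and S
        by (cases d) (simp_all add: sum_negf)
      then show ?thesis using True by (simp add: multi_ext_def sum.distrib)
    qed
    also have "\<dots> = (\<Sum>ds\<in>{ds. length ds = Suc n}. lie_diff ?D (components ds xs))"
      by (intro sum.cong refl lie_diff_unshuffle_sum[OF alt, symmetric]) (use True all_hom_components in auto)
    finally show ?thesis using True by (simp add: multi_ext_def)
  qed
qed

lemma delta_linear:
  "delta sL GL br n (\<lambda>xs. sL c (D xs) + E xs) xs = sL c (delta sL GL br n D xs) + delta sL GL br n E xs"
proof -
  have m: "bracket_map br ((sL c x + y) # xs) = sL c (bracket_map br (x # xs)) + bracket_map br (y # xs)" for x y xs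
    by (auto simp: bracket_map_def br_add_left br_scale_left split: list.splits)
  have "circ sL GL 1 q (bracket_map br) (\<lambda>xs. sL c (D xs) + E xs) xs
    = sL c (circ sL GL 1 q (bracket_map br) D xs) + circ sL GL 1 q (bracket_map br) E xs" for q
    by (simp add: circ_def Let_def m sum.distrib scale_sum_right scale_right_distrib mult.commute)
  moreover have "circ sL GL q 1 (\<lambda>xs. sL c (D xs) + E xs) (bracket_map br) xs
    = sL c (circ sL GL q 1 D (bracket_map br) xs) + circ sL GL q 1 E (bracket_map br) xs" for q
    by (simp add: circ_def Let_def sum.distrib scale_sum_right scale_right_distrib mult.commute)
  ultimately show ?thesis
    by (simp add: delta_def Der_bracket_def scale_right_distrib scale_right_diff_distrib mult.commute)
qed

end

section \<open>Cochains\<close>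

lemma map_zip_update2:
  assumes "length ds = length xs" "Suc i < length xs"
  shows "zip ds xs = take i (zip ds xs) @ (ds ! i, xs ! i) # (ds ! Suc i, xs ! Suc i) # drop (Suc (Suc i)) (zip ds xs)"
    "xs[i := xs ! Suc i, Suc i := xs ! i]
      = map snd (take i (zip ds xs) @ (ds ! Suc i, xs ! Suc i) # (ds ! i, xs ! i) # drop (Suc (Suc i)) (zip ds xs))"
proof -
  show *: "zip ds xs = take i (zip ds xs) @ (ds ! i, xs ! i) # (ds ! Suc i, xs ! Suc i) # drop (Suc (Suc i)) (zip ds xs)"
    using assms id_take_nth_drop[of i "zip ds xs"] Cons_nth_drop_Suc[of "Suc i" "zip ds xs"] by simp
  have "map snd (take i (zip ds xs)) = take i xs"
    and "map snd (drop (Suc (Suc i)) (zip ds xs)) = drop (Suc (Suc i)) xs"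
    using assms by (simp_all flip: take_map drop_map)
  then show "xs[i := xs ! Suc i, Suc i := xs ! i]
      = map snd (take i (zip ds xs) @ (ds ! Suc i, xs ! Suc i) # (ds ! i, xs ! i) # drop (Suc (Suc i)) (zip ds xs))"
    using assms
    by (intro nth_equalityI) (auto simp: nth_append nth_list_update nth_Cons min_def
        split: nat.splits intro!: arg_cong[of _ _ "(!) xs"])
qed

context supercommutative_superalgebra
begin

lemma DerA_superderivation:
  assumes "superderivation sA GA d D"
  shows "D \<in> DerA sA GA"
proof (cases d)
  case zero
  then show ?thesis
    unfolding DerA_def using assms superderivation_zero[of 1]
    by (intro CollectI exI[of _ D] exI[of _ "\<lambda>_. 0"]) auto
next
  case one
  then show ?thesis
    unfolding DerA_def using assms superderivation_zero[of 0]
    by (intro CollectI exI[of _ "\<lambda>_. 0"] exI[of _ D]) auto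
qed

lemma DerA_add:
  assumes "D \<in> DerA sA GA" "E \<in> DerA sA GA"
  shows "(\<lambda>a. D a + E a) \<in> DerA sA GA"
proof -
  obtain D0 D1 E0 E1 where DE: "D = (\<lambda>a. D0 a + D1 a)" "E = (\<lambda>a. E0 a + E1 a)"
    "superderivation sA GA 0 D0" "superderivation sA GA 1 D1"
    "superderivation sA GA 0 E0" "superderivation sA GA 1 E1"
    using assms unfolding DerA_def by blast
  have "(\<lambda>a. D a + E a) = (\<lambda>a. (D0 a + E0 a) + (D1 a + E1 a))"
    by (simp add: DE ac_simps)
  then show ?thesis
    unfolding DerA_def
    by (intro CollectI exI[of _ "\<lambda>a. D0 a + E0 a"] exI[of _ "\<lambda>a. D1 a + E1 a"] conjI superderivation_add DE)
qed

lemma DerA_sum: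
  assumes "finite S" "\<And>x. x \<in> S \<Longrightarrow> D x \<in> DerA sA GA"
  shows "(\<lambda>a. \<Sum>x\<in>S. D x a) \<in> DerA sA GA"
  using assms
proof (induction S rule: finite_induct)
  case empty
  then show ?case using DerA_superderivation[OF superderivation_zero] by simp
next
  case (insert x S)
  then show ?case using DerA_add[of "D x" "\<lambda>a. \<Sum>x\<in>S. D x a"] by simp
qed

text \<open>A symbol of a homogeneous map may have a part of the wrong degree, which annihilates \<open>L\<close>.
  Commutators with \<open>\<rho> u\<close> carry the right signs only after this part is removed.\<close>

definition graded_part :: "bit \<Rightarrow> ('a \<Rightarrow> 'a) \<Rightarrow> 'a \<Rightarrow> 'a" where
  "graded_part d T a = component GA d (T (component GA 0 a)) + component GA (d + 1) (T (component GA 1 a))"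

text \<open>In any decomposition of \<open>T\<close> into an even and an odd superderivation, the
  part of degree \<open>d\<close> is \<open>graded_part d T\<close>. The formula by components makes
  its linear dependence on \<open>T\<close> visible, which is needed to see that the corrected
  symbol is still multilinear.\<close>

lemma graded_part_DerA:
  assumes "T \<in> DerA sA GA"
  shows "superderivation sA GA d (graded_part d T)"
    "\<exists>T'. superderivation sA GA (d + 1) T' \<and> (\<forall>a. T a = graded_part d T a + T' a)"
proof -
  obtain D where D: "\<And>d. superderivation sA GA d (D d)" "T = (\<lambda>a. D 0 a + D 1 a)"
  proof -
    obtain D0 D1 where "superderivation sA GA 0 D0" "superderivation sA GA 1 D1" "T = (\<lambda>a. D0 a + D1 a)"
      using assms unfolding DerA_def by blast
    then show thesis
      by (intro that[of "\<lambda>d. if d = 0 then D0 else D1"]) auto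
  qed
  have T: "T a = D d a + D (d + 1) a" for a
    by (cases d) (simp_all add: D(2) add.commute)
  have deg: "D d a \<in> GA (d + i)" if "a \<in> GA i" for d a i
    using D(1)[of d] that by (simp add: superderivation_iff)
  have comp: "component GA (d + i) (T a) = D d a" if "a \<in> GA i" for a i
    by (rule component_unique) (use deg[OF that, of d] deg[OF that, of "d + 1"] in \<open>auto simp: T ac_simps\<close>)
  have "graded_part d T = D d"
  proof
    fix a
    interpret D: Vector_Spaces.linear sA sA "D d" using D(1) by (rule superderivation_linear)
    have "graded_part d T a = D d (component GA 0 a) + D d (component GA 1 a)"
      using comp[OF component_spec(1)[of 0 a]] comp[OF component_spec(1)[of 1 a]]
      by (simp add: graded_part_def)
    then show "graded_part d T a = D d a" by (simp add: component_decomp flip: D.add)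
  qed
  then show "superderivation sA GA d (graded_part d T)"
    "\<exists>T'. superderivation sA GA (d + 1) T' \<and> (\<forall>a. T a = graded_part d T a + T' a)"
    using D(1) T by auto
qed

end

section \<open>Homogeneous cochains and their closure under the operator\<close>

context lie_rinehart_superalgebra
begin

text \<open>\<open>n\<close> counts arguments, so that elements of \<open>L\<close>
  (\<open>n = 0\<close>) and multiderivations are treated alike. The symbol is required to have
  values of the right degree, and its conditions range over lists of every length, as the recursions
  demand.\<close>

definition cochain :: "nat \<Rightarrow> bit \<Rightarrow> ('l list \<Rightarrow> 'l) \<Rightarrow> bool" where
  "cochain n j f \<longleftrightarrow> (let D = \<lambda>zs. f (map snd zs) in
     (\<forall>xs. length xs \<noteq> n \<longrightarrow> f xs = 0) \<and> slot_linear sL sL D \<and> slot_skew GL D \<and> slot_degree GL j D \<and>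
     (\<exists>\<sigma>. has_symbol j D \<sigma> \<and> graded_der j \<sigma> \<and> (\<forall>a. slot_linear sL sA (\<lambda>zs. \<sigma> zs a)) \<and>
       (\<forall>zs. Vector_Spaces.linear sA sA (\<sigma> zs))))"

lemma cochain_Cdef_0:
  assumes "f \<in> Cdef sA GA sL GL act 0"
  shows "cochain 0 d (\<lambda>xs. component GL d (f xs))"
proof -
  have f: "f xs = 0" if "xs \<noteq> []" for xs using assms that by (simp add: Cdef_def)
  have [simp]: "component GL d 0 = 0" by (rule L.component_same) simp
  have "slot_linear sL sL (\<lambda>zs. component GL d (f (map snd zs)))" by (simp add: slot_linear_def f)
  moreover have "slot_skew GL (\<lambda>zs. component GL d (f (map snd zs)))" by (simp add: slot_skew_def f)
  moreover have "slot_degree GL d (\<lambda>zs. component GL d (f (map snd zs)))"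
    unfolding slot_degree_def
  proof (intro allI impI)
    fix zs show "component GL d (f (map snd zs)) \<in> GL (d + total_degree zs)"
      by (cases zs) (simp_all add: f L.component_spec)
  qed
  moreover have "has_symbol d (\<lambda>zs. component GL d (f (map snd zs))) (\<lambda>zs a. 0)" by (simp add: has_symbol_def f)
  moreover have "graded_der d (\<lambda>zs a. 0)" by (simp add: graded_der_def A.superderivation_zero)
  moreover have "slot_linear sL sA (\<lambda>zs. 0)" by (simp add: slot_linear_def)
  ultimately show ?thesis
    unfolding cochain_def Let_def using A.linear_zero f by (intro conjI exI[of _ "\<lambda>zs a. 0"]) auto
qed

lemma cochain_Der_homogeneous:
  assumes "f \<in> Der_homogeneous sA GA sL GL act n j"
  shows "cochain (Suc n) j f"
proof -
  let ?D = "\<lambda>zs. f (map snd zs)"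
  have off: "f xs = 0" if "length xs \<noteq> Suc n" for xs
    using assms that by (simp add: Der_homogeneous_def)
  have mult: "multilinear sL sL (Suc n) f" using assms by (simp add: Der_homogeneous_def)
  have degf: "f xs \<in> GL (j + sum_list ds)" if "length xs = Suc n" "homogeneous GL ds xs" for ds xs
    using assms that by (simp add: Der_homogeneous_def)
  have skewf: "f xs = - sL (psign (ds ! i * ds ! (i + 1))) (f (xs[i := xs ! (i + 1), i + 1 := xs ! i]))"
    if "length xs = n + 1" "homogeneous GL ds xs" "i < n" for ds xs i
    using assms that unfolding Der_homogeneous_def by blast
  obtain \<sigma> where \<sigma>: "is_symbol sA GA sL GL act n j f \<sigma>" using assms by (auto simp: Der_homogeneous_def)
  have lin: "slot_linear sL sL ?D" by (rule multilinear_slot_linear[OF mult off L.vector_space_axioms])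
  have alt: "slot_skew GL ?D"
    unfolding slot_skew_def
  proof (intro allI impI)
    fix zs u v zs' assume h: "all_hom GL (zs @ u # v # zs')"
    let ?zs = "zs @ u # v # zs'"
    show "?D ?zs = - signed (fst u * fst v) (?D (zs @ v # u # zs'))"
    proof (cases "length ?zs = Suc n")
      case True
      have "f (map snd ?zs) = - sL (psign (map fst ?zs ! length zs * map fst ?zs ! (length zs + 1)))
         (f ((map snd ?zs)[length zs := map snd ?zs ! (length zs + 1), length zs + 1 := map snd ?zs ! length zs]))"
        by (rule skewf[OF _ homogeneous_map[THEN iffD2, OF h]]) (use True in auto)
      moreover have "(map snd ?zs)[length zs := map snd ?zs ! (length zs + 1), length zs + 1 := map snd ?zs ! length zs]
          = map snd (zs @ v # u # zs')"
        by (simp add: nth_append list_update_append)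
      ultimately show ?thesis by (simp add: nth_append L.scale_psign)
    qed (simp add: off)
  qed
  have deg: "slot_degree GL j ?D"
    unfolding slot_degree_def
  proof (intro allI impI)
    fix zs assume "all_hom GL zs"
    then show "?D zs \<in> GL (j + total_degree zs)"
      using degf[of "map snd zs" "map fst zs"] off[of "map snd zs"]
      by (cases "length zs = Suc n") (auto simp: homogeneous_map total_degree_def)
  qed
  \<comment> \<open>The value zero at other lengths serves the conditions of \<open>cochain\<close>,
    which fix no length.\<close>
  define \<tau> where "\<tau> zs = (if length zs = n then A.graded_part (j + total_degree zs) (\<sigma> (map snd zs)) else (\<lambda>a. 0))"
    for zs :: "(bit \<times> 'l) list"
  have \<sigma>_Der: "\<sigma> xs \<in> DerA sA GA" if "length xs = n" for xs
    using \<sigma> that by (simp add: is_symbol_def)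
  have \<tau>_der: "superderivation sA GA (j + total_degree zs) (\<tau> zs)" for zs
    unfolding \<tau>_def using A.graded_part_DerA(1)[OF \<sigma>_Der] A.superderivation_zero by simp
  have "graded_der j \<tau>" using \<tau>_der by (simp add: graded_der_def)
  moreover have "Vector_Spaces.linear sA sA (\<tau> zs)" for zs
    using \<tau>_der by (rule A.superderivation_linear)
  moreover have "slot_linear sL sA (\<lambda>zs. \<tau> zs a)" for a
  proof -
    \<comment> \<open>\<open>\<sigma>\<close> is unconstrained at lists of other lengths, while
      \<open>slot_linear\<close> ranges over all of them; hence the cutoff.\<close>
    define \<sigma>' where "\<sigma>' b xs = (if length xs = n then \<sigma> xs b else 0)" for b xs
    have "multilinear sL sA n (\<lambda>xs. \<sigma> xs b)" for b using \<sigma> by (simp add: is_symbol_def)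
    then have "multilinear sL sA n (\<sigma>' b)" for b by (simp add: multilinear_def \<sigma>'_def)
    from multilinear_slot_linear[OF this _ A.vector_space_axioms]
    have \<sigma>': "slot_linear sL sA (\<lambda>zs. \<sigma>' b (map snd zs))" for b by (simp add: \<sigma>'_def)
    have [simp]: "component GA d 0 = 0" for d by (rule A.component_same) simp
    have \<tau>: "\<tau> zs a = component GA (j + total_degree zs) (\<sigma>' (component GA 0 a) (map snd zs))
        + component GA (j + total_degree zs + 1) (\<sigma>' (component GA 1 a) (map snd zs))" for zs
      by (simp add: \<tau>_def \<sigma>'_def A.graded_part_def)
    show ?thesis
      unfolding slot_linear_def \<tau> slot_linearD[OF \<sigma>'] A.component_linear
      by (simp add: A.component_linear A.scale_right_distrib ac_simps)
  qed
  moreover have "has_symbol j ?D \<tau>"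
    unfolding has_symbol_def
  proof (intro allI impI)
    fix zs a e d y assume h: "all_hom GL zs" "a \<in> GA e" "y \<in> GL d"
    show "?D (zs @ [(e + d, act a y)]) = signed (e * (j + total_degree zs)) (act a (?D (zs @ [(d, y)]))) + act (\<tau> zs a) y"
    proof (cases "length zs = n")
      case True
      let ?k = "j + total_degree zs"
      obtain T where T: "superderivation sA GA (?k + 1) T" "\<And>a. \<sigma> (map snd zs) a = \<tau> zs a + T a"
        using A.graded_part_DerA(2)[OF \<sigma>_Der, of "map snd zs" ?k] True by (auto simp: \<tau>_def)
      have eq: "?D (zs @ [(e + d, act a y)]) = signed (e * ?k) (act a (?D (zs @ [(d, y)]))) + act (\<sigma> (map snd zs) a) y"
        using \<sigma> True h unfolding is_symbol_def
        by (auto simp: homogeneous_map L.scale_psign total_degree_def dest!: spec[of _ "map fst zs"] spec[of _ "map snd zs"])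
      have "?D (zs @ [(e + d, act a y)]) \<in> GL (?k + e + d)"
        using slot_degreeD[OF deg, of "zs @ [(e + d, act a y)]"] h act_degree[OF h(2,3)]
        by (simp add: ac_simps)
      moreover have "act a (?D (zs @ [(d, y)])) \<in> GL (e + (?k + d))"
        using slot_degreeD[OF deg, of "zs @ [(d, y)]"] h by (intro act_degree) (auto simp: ac_simps)
      moreover have "act (\<tau> zs a) y \<in> GL (?k + e + d)"
        using \<tau>_der[of zs] h by (intro act_degree) (auto simp: A.superderivation_iff)
      \<comment> \<open>The wrong part is thereby a difference of terms of the right degree, while
        \<open>T\<close> itself shifts to the other degree; an element with both degrees is
        zero.\<close>
      moreover have "act (T a) y = ?D (zs @ [(e + d, act a y)]) - signed (e * ?k) (act a (?D (zs @ [(d, y)]))) - act (\<tau> zs a) y"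
        unfolding eq T(2) by (simp add: act_add_left)
      ultimately have "act (T a) y \<in> GL (?k + e + d)"
        by (auto simp: ac_simps intro!: L.G_diff L.G_signed)
      moreover have "act (T a) y \<in> GL (?k + 1 + e + d)"
        using T(1) h by (intro act_degree) (auto simp: A.superderivation_iff)
      moreover have "?k + e + d \<noteq> ?k + 1 + e + d" by simp
      ultimately have "act (T a) y = 0" by (rule L.G_both)
      then show ?thesis using eq by (simp add: T(2) act_add_left)
    next
      case False
      then show ?thesis by (simp add: off \<tau>_def)
    qed
  qed
  ultimately show ?thesis unfolding cochain_def Let_def using off lin alt deg by blast
qed

text \<open>Each condition is known for \<open>lie_diff\<close> at labelled arguments and carries
  over through \<open>multi_ext\<close>. For \<open>n = 0\<close> the symbol obtained is
  \<open>\<rho>\<close> of the given element of \<open>L\<close>.\<close>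

lemma delta_Der_homogeneous:
  assumes "cochain n j f"
  shows "delta sL GL br n f \<in> Der_homogeneous sA GA sL GL act n j"
proof -
  let ?D = "\<lambda>zs. f (map snd zs)" and ?g = "delta sL GL br n f"
  have lin: "slot_linear sL sL ?D" and alt: "slot_skew GL ?D" and deg: "slot_degree GL j ?D"
    using assms by (simp_all add: cochain_def Let_def)
  obtain \<sigma> where \<sigma>: "has_symbol j ?D \<sigma>" "graded_der j \<sigma>" "\<And>a. slot_linear sL sA (\<lambda>zs. \<sigma> zs a)"
      "\<And>zs. Vector_Spaces.linear sA sA (\<sigma> zs)"
    using assms by (auto simp: cochain_def Let_def)
  have g_ext: "?g = L.multi_ext (Suc n) (L.lie_diff ?D)" by (rule L.delta_lie_diff[OF alt])
  have lie_diff_lin: "slot_linear sL sL (L.lie_diff ?D)" by (rule L.lie_diff_slot_linear[OF lin])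
  have g_hom: "?g (map snd zs) = L.lie_diff ?D zs" if "all_hom GL zs" "length zs = Suc n" for zs
    unfolding g_ext by (rule L.multi_ext_hom[OF L.vector_space_axioms lie_diff_lin that])
  have g_zip: "?g xs = L.lie_diff ?D (zip ds xs)" if "length xs = Suc n" "homogeneous GL ds xs" for ds xs
    using g_hom[of "zip ds xs"] that homogeneous_length[OF that(2)] by (simp add: all_hom_zip)
  have mult: "multilinear sL sL (Suc n) ?g"
    unfolding g_ext by (rule L.multi_ext_multilinear[OF L.vector_space_axioms lie_diff_lin])
  have g_deg: "?g xs \<in> GL (j + sum_list ds)" if "length xs = Suc n" "homogeneous GL ds xs" for ds xs
    using slot_degreeD[OF L.lie_diff_slot_degree[OF deg], of "zip ds xs"] that homogeneous_length[OF that(2)]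
    by (simp add: g_zip all_hom_zip total_degree_zip)
  have g_skew: "?g xs = - sL (psign (ds ! i * ds ! (i + 1))) (?g (xs[i := xs ! (i + 1), i + 1 := xs ! i]))"
    if xs: "length xs = Suc n" "homogeneous GL ds xs" "i < n" for ds xs i
  proof -
    let ?A = "take i (zip ds xs)" and ?B = "drop (Suc (Suc i)) (zip ds xs)"
    let ?u = "(ds ! i, xs ! i)" and ?v = "(ds ! Suc i, xs ! Suc i)"
    have len: "length ds = length xs" by (rule homogeneous_length[OF xs(2)])
    have "Suc i < length xs" using xs by simp
    note z = map_zip_update2[OF len this]
    have h: "all_hom GL (?A @ ?u # ?v # ?B)" using z(1) all_hom_zip[OF len] xs(2) by simp
    have "?g xs = L.lie_diff ?D (?A @ ?u # ?v # ?B)" using g_zip[OF xs(1,2)] z(1) by simp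
    also have "\<dots> = - signed (ds ! i * ds ! Suc i) (L.lie_diff ?D (?A @ ?v # ?u # ?B))"
      using L.lie_diff_slot_skew_eq[OF lin alt h] by simp
    also have "L.lie_diff ?D (?A @ ?v # ?u # ?B) = ?g (xs[i := xs ! Suc i, Suc i := xs ! i])"
      unfolding z(2) by (rule g_hom[symmetric]) (use h xs len in auto)
    finally show ?thesis by (simp add: L.scale_psign)
  qed
  let ?s = "lie_diff_symbol j ?D \<sigma>"
  have s_lin: "slot_linear sL sA (\<lambda>zs. ?s zs a)" for a
    unfolding slot_linear_def using lie_diff_symbol_slot_linear_eq[OF lin \<sigma>(3,4)] by blast
  \<comment> \<open>At arbitrary arguments this is a sum of superderivations of different degrees,
    which is why the target is \<open>DerA\<close> and no single degree is claimed.\<close>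
  let ?\<Sigma> = "\<lambda>xs a. L.multi_ext n (\<lambda>zs. ?s zs a) xs"
  have "is_symbol sA GA sL GL act n j ?g ?\<Sigma>"
    unfolding is_symbol_def
  proof (intro conjI allI impI)
    fix xs :: "'l list" assume xs: "length xs = n"
    have "?s (L.components es xs) \<in> DerA sA GA" if "length es = n" for es
      using A.DerA_superderivation[OF lie_diff_symbol_graded_der_eq[OF \<sigma>(2) deg]] L.all_hom_components[of es xs] xs that by simp
    then have "(\<lambda>a. \<Sum>es\<in>{es. length es = n}. ?s (L.components es xs) a) \<in> DerA sA GA"
      by (intro A.DerA_sum finite_bit_lists) simp
    then show "?\<Sigma> xs \<in> DerA sA GA" using xs by (simp add: L.multi_ext_def)
  next
    fix a show "multilinear sL sA n (\<lambda>xs. ?\<Sigma> xs a)"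
      by (rule L.multi_ext_multilinear[OF A.vector_space_axioms s_lin])
  next
    fix es xs e a y assume h: "length xs = n \<and> homogeneous GL es xs \<and> a \<in> GA e"
    let ?zs = "zip es xs"
    have len: "length es = length xs" using homogeneous_length h by blast
    have zs: "all_hom GL ?zs" "map snd ?zs = xs" "total_degree ?zs = sum_list es" "length ?zs = n"
      using h len by (simp_all add: all_hom_zip total_degree_zip)
    have S: "?\<Sigma> xs a = ?s ?zs a"
      using L.multi_ext_hom[OF A.vector_space_axioms s_lin zs(1,4)] zs(2) by simp
    \<comment> \<open>The entry \<open>0\<close> is a placeholder to be overwritten. Linearity in
      the last slot reduces the symbol rule to homogeneous \<open>y\<close>.\<close>
    have "Vector_Spaces.linear sL sL (\<lambda>y. ?g ((xs @ [0])[n := y]))"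
      using mult h unfolding multilinear_def by simp
    moreover have n: "n = length xs" using h by simp
    have "(xs @ [0])[n := y] = xs @ [y]" for y
      unfolding n by (rule list_update_length)
    ultimately interpret l: Vector_Spaces.linear sL sL "\<lambda>y. ?g (xs @ [y])" by simp
    have *: "?g (xs @ [act a y]) = signed (e * (j + sum_list es)) (act a (?g (xs @ [y]))) + act (?\<Sigma> xs a) y"
      if y: "y \<in> GL d" for d y
    proof -
      have "?g (xs @ [act a y]) = L.lie_diff ?D (?zs @ [(e + d, act a y)])"
        using g_hom[of "?zs @ [(e + d, act a y)]"] zs h y act_degree by simp
      moreover have "?g (xs @ [y]) = L.lie_diff ?D (?zs @ [(d, y)])"
        using g_hom[of "?zs @ [(d, y)]"] zs y by simp
      ultimately show ?thesis
        using lie_diff_has_symbol_eq[OF lin deg \<sigma>(2,1) zs(1), of a e y d] h y unfolding S zs(3) by simp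
    qed
    let ?y = "\<lambda>d. component GL d y"
    have y: "y = ?y 0 + ?y 1" by (simp add: L.component_decomp)
    have "?g (xs @ [act a y]) = signed (e * (j + sum_list es)) (act a (?g (xs @ [y]))) + act (?\<Sigma> xs a) y"
      by (subst (1 2 3) y)
        (simp add: act_add_right l.add *[OF L.component_spec(1)] signed_add)
    then show "?g (xs @ [act a y]) = sL (psign (e * (j + sum_list es))) (act a (?g (xs @ [y]))) + act (?\<Sigma> xs a) y"
      by (simp add: L.scale_psign)
  qed
  then have "\<exists>\<Sigma>. is_symbol sA GA sL GL act n j ?g \<Sigma>" by blast
  then show ?thesis
    unfolding Der_homogeneous_def using L.delta_off[of _ n f] mult g_deg g_skew by auto
qed

text \<open>\<open>delta_lie_diff\<close> is used twice, the second time for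
  \<open>delta sL GL br n f\<close>, whose skew-symmetry comes from its being a cochain
  again.\<close>

lemma delta_delta_cochain:
  assumes "cochain n j f"
  shows "delta sL GL br (Suc n) (delta sL GL br n f) = (\<lambda>_. 0)"
proof -
  let ?D = "\<lambda>zs. f (map snd zs)" and ?g = "delta sL GL br n f"
  have lin: "slot_linear sL sL ?D" and alt: "slot_skew GL ?D" and off: "\<And>xs. length xs \<noteq> n \<Longrightarrow> f xs = 0"
    using assms by (simp_all add: cochain_def Let_def)
  have "cochain (Suc n) j ?g"
    by (rule cochain_Der_homogeneous[OF delta_Der_homogeneous[OF assms]])
  then have alt': "slot_skew GL (\<lambda>zs. ?g (map snd zs))" by (simp add: cochain_def Let_def)
  have g_hom: "?g (map snd zs) = L.lie_diff ?D zs" if "all_hom GL zs" "length zs = Suc n" for zs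
    unfolding L.delta_lie_diff[OF alt] by (rule L.multi_ext_hom[OF L.vector_space_axioms L.lie_diff_slot_linear[OF lin] that])
  have *: "L.lie_diff (\<lambda>zs. ?g (map snd zs)) zs = 0" if "all_hom GL zs" "length zs = Suc (Suc n)" for zs
  proof -
    \<comment> \<open>The plain map and \<open>lie_diff ?D\<close> agree only at homogeneous lists
      of length \<open>Suc n\<close>, but the outer differential evaluates at no others.\<close>
    have "L.lie_diff (\<lambda>zs. ?g (map snd zs)) zs = L.lie_diff (L.lie_diff ?D) zs"
      by (rule L.lie_diff_cong) (use that g_hom in auto)
    then show ?thesis using L.lie_diff_lie_diff[OF lin that(1)] by simp
  qed
  show ?thesis
    unfolding L.delta_lie_diff[OF alt'] L.multi_ext_def
    by (intro ext) (auto intro!: sum.neutral * L.all_hom_components)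
qed

lemma Cdef_cochains:
  assumes "f \<in> Cdef sA GA sL GL act n"
  obtains f0 f1 where "f = (\<lambda>xs. f0 xs + f1 xs)" "cochain n 0 f0" "cochain n 1 f1"
proof (cases n)
  case 0
  show thesis
  proof (rule that)
    show "f = (\<lambda>xs. component GL 0 (f xs) + component GL 1 (f xs))" by (simp add: L.component_decomp)
  qed (use assms 0 cochain_Cdef_0 in auto)
next
  case (Suc k)
  then show thesis
    using assms that cochain_Der_homogeneous by (auto simp: Cdef_def Der_def)
qed

lemma bracket_map_cochain:
  shows "bracket_map br \<in> Der_homogeneous sA GA sL GL act 1 0"
    and "is_symbol sA GA sL GL act 1 0 (bracket_map br) (\<lambda>xs. \<rho> (hd xs))"
proof -
  have len2: "\<exists>x y. xs = [x, y]" if "length xs = 2" for xs :: "'l list"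
    using that by (auto simp: numeral_2_eq_2 length_Suc_conv)
  have len1: "\<exists>x. xs = [x]" if "length xs = 1" for xs :: "'l list"
    using that by (auto simp: length_Suc_conv)
  have off: "bracket_map br xs = 0" if "length xs \<noteq> 1 + 1" for xs
    using that by (auto simp: bracket_map_def split: list.splits)
  have mult: "multilinear sL sL (1 + 1) (bracket_map br)"
    unfolding multilinear_def
  proof (intro allI impI)
    fix xs :: "'l list" and i :: nat assume h: "length xs = 1 + 1 \<and> i < 1 + 1"
    then obtain x y where "xs = [x, y]" using len2[of xs] by auto
    moreover have "i = 0 \<or> i = 1" using h by auto
    ultimately show "Vector_Spaces.linear sL sL (\<lambda>x. bracket_map br (xs[i := x]))"
      using L.br_linear_left L.br_linear_right by (auto simp: bracket_map_def)
  qed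
  have deg: "bracket_map br xs \<in> GL (0 + sum_list ds)"
    and skew: "i < 1 \<Longrightarrow> bracket_map br xs = - sL (psign (ds ! i * ds ! (i + 1)))
                   (bracket_map br (xs[i := xs ! (i + 1), i + 1 := xs ! i]))"
    if h: "length xs = 1 + 1 \<and> homogeneous GL ds xs" for xs ds i
  proof -
    obtain x y where xs: "xs = [x, y]" using len2[of xs] h by auto
    then obtain d e where ds: "ds = [d, e]" "x \<in> GL d" "y \<in> GL e"
      using h by (auto simp: homogeneous_def list_all2_Cons2)
    show "bracket_map br xs \<in> GL (0 + sum_list ds)"
      using L.br_even[OF ds(2,3)] by (simp add: bracket_map_def xs ds)
    show "i < 1 \<Longrightarrow> bracket_map br xs = - sL (psign (ds ! i * ds ! (i + 1)))
                   (bracket_map br (xs[i := xs ! (i + 1), i + 1 := xs ! i]))"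
      using L.br_skew[OF ds(2,3)] by (simp add: bracket_map_def xs ds(1))
  qed
  show sym: "is_symbol sA GA sL GL act 1 0 (bracket_map br) (\<lambda>xs. \<rho> (hd xs))"
    unfolding is_symbol_def
  proof (intro conjI allI impI)
    fix xs :: "'l list"
    let ?c = "\<lambda>d. component GL d (hd xs)"
    have "\<rho> (hd xs) = (\<lambda>a. \<rho> (?c 0) a + \<rho> (?c 1) a)"
      using rho_combination[of 1 "?c 0" "?c 1"] by (auto simp: L.component_decomp)
    then show "\<rho> (hd xs) \<in> DerA sA GA"
      unfolding DerA_def using rho_even[OF L.component_spec(1)]
      by (intro CollectI exI[of _ "\<rho> (?c 0)"] exI[of _ "\<rho> (?c 1)"]) simp
  next
    fix a show "multilinear sL sA 1 (\<lambda>xs. \<rho> (hd xs) a)"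
      unfolding multilinear_def
    proof (intro allI impI)
      fix xs :: "'l list" and i :: nat assume h: "length xs = 1 \<and> i < 1"
      then obtain x where "xs = [x]" using len1 by blast
      then show "Vector_Spaces.linear sL sA (\<lambda>x. \<rho> (hd (xs[i := x])) a)"
        using h rho_linear by simp
    qed
  next
    fix ds xs e a y assume h: "length xs = 1 \<and> homogeneous GL ds xs \<and> a \<in> GA e"
    then obtain x where xs: "xs = [x]" using len1 by blast
    then obtain d where ds: "ds = [d]" "x \<in> GL d"
      using h by (auto simp: homogeneous_def list_all2_Cons2)
    show "bracket_map br (xs @ [act a y]) = sL (psign (e * (0 + sum_list ds))) (act a (bracket_map br (xs @ [y])))
        + act (\<rho> (hd xs) a) y"
      using br_act[OF ds(2), of a e y] h by (simp add: bracket_map_def xs ds(1) add.commute)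
  qed
  show "bracket_map br \<in> Der_homogeneous sA GA sL GL act 1 0"
    unfolding Der_homogeneous_def using off mult deg skew sym by blast
qed

lemma zero_Der_homogeneous: "(\<lambda>_. 0) \<in> Der_homogeneous sA GA sL GL act n j"
proof -
  have "Vector_Spaces.linear sL sL (\<lambda>x. 0)" "Vector_Spaces.linear sL sA (\<lambda>x. 0)"
    by (rule linearI_combination; simp add: L.vector_space_axioms A.vector_space_axioms)+
  then have "is_symbol sA GA sL GL act n j (\<lambda>_. 0) (\<lambda>_ _. 0)"
    using A.DerA_superderivation[OF A.superderivation_zero] by (simp add: is_symbol_def multilinear_def)
  then show ?thesis
    using \<open>Vector_Spaces.linear sL sL (\<lambda>x. 0)\<close> by (auto simp: Der_homogeneous_def multilinear_def)
qed

lemma bracket_map_Der: "bracket_map br \<in> Der sA GA sL GL act 1"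
proof -
  show ?thesis
    unfolding Der_def using bracket_map_cochain(1) zero_Der_homogeneous[of 1 1]
    by (intro CollectI exI[of _ "bracket_map br"] exI[of _ "\<lambda>_. 0"]) simp
qed

lemma delta_Cdef:
  assumes "f \<in> Cdef sA GA sL GL act n"
  shows "delta sL GL br n f \<in> Cdef sA GA sL GL act (Suc n)"
    "delta sL GL br (Suc n) (delta sL GL br n f) = (\<lambda>_. 0)"
proof -
  obtain f0 f1 where f: "f = (\<lambda>xs. f0 xs + f1 xs)" "cochain n 0 f0" "cochain n 1 f1"
    by (rule Cdef_cochains[OF assms])
  have add: "delta sL GL br m (\<lambda>xs. g xs + h xs) = (\<lambda>xs. delta sL GL br m g xs + delta sL GL br m h xs)" for m g h
    using L.delta_linear[of m 1 g h] by (auto simp: fun_eq_iff)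
  show "delta sL GL br n f \<in> Cdef sA GA sL GL act (Suc n)"
    unfolding f(1) add Cdef_def Der_def
    using f(2,3)[THEN delta_Der_homogeneous] by auto
  show "delta sL GL br (Suc n) (delta sL GL br n f) = (\<lambda>_. 0)"
    unfolding f(1) add using f(2,3)[THEN delta_delta_cochain] by simp
qed

end

theorem proposition4p6:
  fixes sA :: "'k::field_char_0 \<Rightarrow> 'a::ring \<Rightarrow> 'a" and GA :: "bit \<Rightarrow> 'a set"
    and sL :: "'k \<Rightarrow> 'l::ab_group_add \<Rightarrow> 'l" and GL :: "bit \<Rightarrow> 'l set"
    and br :: "'l \<Rightarrow> 'l \<Rightarrow> 'l" and act :: "'a \<Rightarrow> 'l \<Rightarrow> 'l" and \<rho> :: "'l \<Rightarrow> 'a \<Rightarrow> 'a"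
  assumes "lie_rinehart_superalgebra sA GA sL GL br act \<rho>"
  shows "bracket_map br \<in> Der sA GA sL GL act 1 \<and>
    is_symbol sA GA sL GL act 1 0 (bracket_map br) (\<lambda>xs. \<rho> (hd xs)) \<and>
    (\<forall>n. \<forall>D\<in>Cdef sA GA sL GL act n. delta sL GL br n D \<in> Cdef sA GA sL GL act (Suc n)) \<and>
    (\<forall>n. \<forall>D\<in>Cdef sA GA sL GL act n. \<forall>E\<in>Cdef sA GA sL GL act n. \<forall>c.
       delta sL GL br n (\<lambda>xs. sL c (D xs) + E xs) =
         (\<lambda>xs. sL c (delta sL GL br n D xs) + delta sL GL br n E xs)) \<and>
    (\<forall>n. \<forall>D\<in>Cdef sA GA sL GL act n. delta sL GL br (Suc n) (delta sL GL br n D) = (\<lambda>_. 0))"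
proof -
  interpret lie_rinehart_superalgebra sA GA sL GL br act \<rho> by fact
  show ?thesis
    using bracket_map_Der bracket_map_cochain(2) delta_Cdef L.delta_linear by blast
qed

end
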